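(* Fix $1\le p\le\infty$ and a norm function $\rho$ on $\mathbb{R}^n$. Suppose $T$ is a convex-set valued operator with the following properties: (1) $T:L^p_{\mathcal{K}}(\mathbb{R}^n,\rho)\to L^p_{\mathcal{K}}(\mathbb{R}^n,\rho)$ with norm $\|T\|_\rho$, $0<\|T\|_\rho<\infty$; (2) $T$ is sublinear and monotone. Given $G\in L^p_{\mathcal{K}}(\mathbb{R}^n,\rho)$, define $$SG(x)=\sum_{k=0}^\infty2^{-k}\|T\|_\rho^{-k}T^kG(x),$$ where $T^kG=T\circ T\circ\cdots\circ TG$ for $k\ge1$ and $T^0G=G$. Then this series converges in $L^p_{\mathcal{K}}(\mathbb{R}^n,\rho)$ and $SG:\mathbb{R}^n\to\mathcal{K}_{bcs}(\mathbb{R}^d)$ is a measurable mapping. Moreover: (1) $G(x)\subset SG(x)$ for a.e. $x$; (2) $\|SG\|_{L^p_{\mathcal{K}}(\mathbb{R}^n,\rho)}\le2\|G\|_{L^p_{\mathcal{K}}(\mathbb{R}^n,\rho)}$; (3) $T(SG)(x)\subset2\|T\|_\rho\,SG(x)$ for a.e. $x$.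
   Context: $\mathcal{K}_{bcs}(\mathbb{R}^d)$: nonempty closed, bounded, convex, symmetric ($-K=K$) subsets of $\mathbb{R}^d$; sums of sets are Minkowski sums. $F:\mathbb{R}^n\to\mathcal{K}_{bcs}(\mathbb{R}^d)$ is measurable if $\{x:F(x)\cap U\ne\emptyset\}$ is measurable for each open $U\subset\mathbb{R}^d$. A norm function is $\rho:\mathbb{R}^n\times\mathbb{R}^d\to[0,\infty)$ with $\rho(\cdot,v)$ measurable for all $v$ and $\rho_x=\rho(x,\cdot)$ a norm for all $x$; $\rho_x(K)=\sup\{\rho_x(v):v\in K\}$. $L^p_{\mathcal{K}}(\mathbb{R}^n,\rho)$ is the set of measurable $F:\mathbb{R}^n\to\mathcal{K}_{bcs}(\mathbb{R}^d)$ (identified when equal a.e.) with $\|F\|=\big(\int\rho_x(F(x))^pdx\big)^{1/p}<\infty$ (ess sup of $\rho_x(F(x))$ if $p=\infty$). It carries the metric $d_p(F,G)=\big(\int d_{H,x}(F(x),G(x))^pdx\big)^{1/p}$ (ess sup if $p=\infty$), where $d_{H,x}(K_1,K_2)=\max\{\sup_{v\in K_1}\inf_{w\in K_2}\rho_x(v-w),\ \sup_{v\in K_2}\inf_{w\in K_1}\rho_x(v-w)\}$; convergence of the series means convergence of partial sums in $d_p$. $\|T\|_\rho$ is the infimum of $C$ with $\|TF\|\le C\|F\|$ for all $F\in L^p_{\mathcal{K}}(\mathbb{R}^n,\rho)$. $T$ sublinear: for all $F,G$ in the space and $\alpha\in\mathbb{R}$, $T(F+G)(x)\subset TF(x)+TG(x)$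 and $T(\alpha F)(x)=\alpha\,TF(x)$. $T$ monotone: if $F(x)\subset G(x)$ for all $x$ then $TF(x)\subset TG(x)$. Pointwise relations between elements of $L^p_{\mathcal{K}}(\mathbb{R}^n,\rho)$ are understood a.e. *)

theory Defs
  imports "HOL-Probability.Essential_Supremum" "HOL-Library.Set_Algebras"
begin

text \<open>Throughout, sums of sets are Minkowski sums (the addition on sets from Set\_Algebras), and
  the scalar multiple of a set \<open>K\<close> by \<open>c\<close> is the image \<open>(*\<^sub>R) c ` K\<close>.\<close>

definition K_bcs :: "('a::euclidean_space) set set" where
  "K_bcs = {K. K \<noteq> {} \<and> closed K \<and> bounded K \<and> convex K \<and> uminus ` K = K}"

definition set_measurable :: "('a::euclidean_space \<Rightarrow> ('b::euclidean_space) set) \<Rightarrow> bool" where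
  "set_measurable F \<longleftrightarrow> (\<forall>U. open U \<longrightarrow> {x. F x \<inter> U \<noteq> {}} \<in> sets lebesgue)"

definition is_norm :: "('b::real_vector \<Rightarrow> real) \<Rightarrow> bool" where
  "is_norm N \<longleftrightarrow>
     (\<forall>v. 0 \<le> N v) \<and> (\<forall>v. N v = 0 \<longleftrightarrow> v = 0) \<and>
     (\<forall>c v. N (c *\<^sub>R v) = \<bar>c\<bar> * N v) \<and> (\<forall>v w. N (v + w) \<le> N v + N w)"

definition norm_function :: "('a::euclidean_space \<Rightarrow> 'b::euclidean_space \<Rightarrow> real) \<Rightarrow> bool" where
  "norm_function \<rho> \<longleftrightarrow>
     (\<forall>v. (\<lambda>x. \<rho> x v) \<in> borel_measurable lebesgue) \<and> (\<forall>x. is_norm (\<rho> x))"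

text \<open>The suprema and infima in the next two definitions are real-valued; they are only used for
  sets in \<open>K_bcs\<close> and norms on a finite-dimensional space, where the sets involved are nonempty
  and bounded.\<close>

definition set_norm :: "('b \<Rightarrow> real) \<Rightarrow> 'b set \<Rightarrow> real" where
  "set_norm N K = (SUP v\<in>K. N v)"

definition hausdorff_dist :: "('b::real_vector \<Rightarrow> real) \<Rightarrow> 'b set \<Rightarrow> 'b set \<Rightarrow> real" where
  "hausdorff_dist N K L =
     max (SUP v\<in>K. INF w\<in>L. N (v - w)) (SUP v\<in>L. INF w\<in>K. N (v - w))"

text \<open>The \<open>L\<^sup>p\<close> norm, possibly infinite, of a nonnegative function on Euclidean space.\<close>

definition Lp_norm :: "ennreal \<Rightarrow> ('a::euclidean_space \<Rightarrow> real) \<Rightarrow> ennreal" where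
  "Lp_norm p f =
     (if p = \<infinity> then esssup lebesgue (\<lambda>x. ennreal (f x))
      else let I = \<integral>\<^sup>+x. ennreal (f x powr enn2real p) \<partial>lebesgue
           in if I = \<infinity> then \<infinity> else ennreal (enn2real I powr (1 / enn2real p)))"

definition LpK_norm ::
  "ennreal \<Rightarrow> ('a::euclidean_space \<Rightarrow> 'b::euclidean_space \<Rightarrow> real) \<Rightarrow> ('a \<Rightarrow> 'b set) \<Rightarrow> ennreal" where
  "LpK_norm p \<rho> F = Lp_norm p (\<lambda>x. set_norm (\<rho> x) (F x))"

definition LpK_dist ::
  "ennreal \<Rightarrow> ('a::euclidean_space \<Rightarrow> 'b::euclidean_space \<Rightarrow> real) \<Rightarrow>
   ('a \<Rightarrow> 'b set) \<Rightarrow> ('a \<Rightarrow> 'b set) \<Rightarrow> ennreal" where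
  "LpK_dist p \<rho> F G = Lp_norm p (\<lambda>x. hausdorff_dist (\<rho> x) (F x) (G x))"

text \<open>The elements of \<open>LpK\<close> are representatives; identification of functions that agree almost
  everywhere is expressed by \<open>AE\<close>.\<close>

definition LpK ::
  "ennreal \<Rightarrow> ('a::euclidean_space \<Rightarrow> 'b::euclidean_space \<Rightarrow> real) \<Rightarrow> ('a \<Rightarrow> 'b set) set" where
  "LpK p \<rho> = {F. (\<forall>x. F x \<in> K_bcs) \<and> set_measurable F \<and> LpK_norm p \<rho> F < \<infinity>}"

definition LpK_tendsto ::
  "ennreal \<Rightarrow> ('a::euclidean_space \<Rightarrow> 'b::euclidean_space \<Rightarrow> real) \<Rightarrow>
   (nat \<Rightarrow> 'a \<Rightarrow> 'b set) \<Rightarrow> ('a \<Rightarrow> 'b set) \<Rightarrow> bool" where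
  "LpK_tendsto p \<rho> X S \<longleftrightarrow>
     (\<forall>N. X N \<in> LpK p \<rho>) \<and> S \<in> LpK p \<rho> \<and> (\<lambda>N. LpK_dist p \<rho> (X N) S) \<longlonglongrightarrow> 0"

text \<open>The second conjunct says that \<open>T\<close> is well defined on almost-everywhere classes. The values of
  \<open>T\<close> outside \<open>LpK\<close> are irrelevant.\<close>

definition LpK_operator ::
  "ennreal \<Rightarrow> ('a::euclidean_space \<Rightarrow> 'b::euclidean_space \<Rightarrow> real) \<Rightarrow>
   (('a \<Rightarrow> 'b set) \<Rightarrow> ('a \<Rightarrow> 'b set)) \<Rightarrow> bool" where
  "LpK_operator p \<rho> T \<longleftrightarrow>
     (\<forall>F\<in>LpK p \<rho>. T F \<in> LpK p \<rho>) \<and>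
     (\<forall>F\<in>LpK p \<rho>. \<forall>G\<in>LpK p \<rho>.
        (AE x in lebesgue. F x = G x) \<longrightarrow> (AE x in lebesgue. T F x = T G x))"

definition op_norm ::
  "ennreal \<Rightarrow> ('a::euclidean_space \<Rightarrow> 'b::euclidean_space \<Rightarrow> real) \<Rightarrow>
   (('a \<Rightarrow> 'b set) \<Rightarrow> ('a \<Rightarrow> 'b set)) \<Rightarrow> ennreal" where
  "op_norm p \<rho> T = Inf {C. \<forall>F\<in>LpK p \<rho>. LpK_norm p \<rho> (T F) \<le> C * LpK_norm p \<rho> F}"

definition sublinear_op ::
  "ennreal \<Rightarrow> ('a::euclidean_space \<Rightarrow> 'b::euclidean_space \<Rightarrow> real) \<Rightarrow>
   (('a \<Rightarrow> 'b set) \<Rightarrow> ('a \<Rightarrow> 'b set)) \<Rightarrow> bool" where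
  "sublinear_op p \<rho> T \<longleftrightarrow>
     (\<forall>F\<in>LpK p \<rho>. \<forall>G\<in>LpK p \<rho>. AE x in lebesgue. T (\<lambda>y. F y + G y) x \<subseteq> T F x + T G x) \<and>
     (\<forall>F\<in>LpK p \<rho>. \<forall>\<alpha>. AE x in lebesgue. T (\<lambda>y. (*\<^sub>R) \<alpha> ` F y) x = (*\<^sub>R) \<alpha> ` T F x)"

definition monotone_op ::
  "ennreal \<Rightarrow> ('a::euclidean_space \<Rightarrow> 'b::euclidean_space \<Rightarrow> real) \<Rightarrow>
   (('a \<Rightarrow> 'b set) \<Rightarrow> ('a \<Rightarrow> 'b set)) \<Rightarrow> bool" where
  "monotone_op p \<rho> T \<longleftrightarrow>
     (\<forall>F\<in>LpK p \<rho>. \<forall>G\<in>LpK p \<rho>.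
        (AE x in lebesgue. F x \<subseteq> G x) \<longrightarrow> (AE x in lebesgue. T F x \<subseteq> T G x))"

definition rdf_partial_sum ::
  "real \<Rightarrow> (('a \<Rightarrow> ('b::real_vector) set) \<Rightarrow> ('a \<Rightarrow> 'b set)) \<Rightarrow> ('a \<Rightarrow> 'b set) \<Rightarrow>
   nat \<Rightarrow> 'a \<Rightarrow> 'b set" where
  "rdf_partial_sum t T G N x =
     (\<Sum>k<N. (*\<^sub>R) (2 powi (- int k) * t powi (- int k)) ` ((T ^^ k) G) x)"

end

theory Submission
  imports Defs
begin

text \<open>The terms of the series are symmetric convex bodies, so they contain the origin and the partial
  sums \<open>X n\<close> increase; the sum is the closure of their union. Its norm and its distance to \<open>X n\<close> are
  controlled pointwise by the scalar series of the norms of the terms, so Minkowski's inequality for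
  countable sums gives convergence and the norm bound. For the last claim write
  \<open>S \<subseteq> X n + R n\<close> with the tail \<open>R n\<close>. Monotonicity and sublinearity give
  \<open>T S \<subseteq> T (X n) + T (R n) \<subseteq> 2 t S + T (R n)\<close>, where \<open>t\<close> is the operator norm, and \<open>T (R n)\<close> tends
  to zero almost everywhere because the norms of the tails are summable.\<close>

subsection \<open>Minkowski's inequality for the \<open>L\<^sup>p\<close> norm\<close>

text \<open>Subadditivity covers finite sums only and no continuity of \<open>T\<close> is assumed,
  so the series cannot be passed through \<open>T\<close> term by term; splitting off a tail reduces
  the task to a finite sum and a remainder. The bound on \<open>T\<close> is global while the
  inclusion is pointwise: convergence of the norms of \<open>T (R n)\<close> to zero would by itself
  give a.e. convergence along a subsequence only. The tails decay geometrically, which makes these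
  norms summable and controls the whole sequence at almost every point. The remainder disappears
  without any loss because the values are compact: distances to them are attained, so distance zero
  means membership. The theorem speaks of every limit of the partial sums, whereas the construction
  yields one. Uniqueness of limits up to null sets, together with \<open>T\<close> respecting a.e.
  equality, transfers the conclusions.\<close>

lemma powr_convex_combination:
  fixes a b u q :: real
  assumes q: "1 \<le> q" and u: "0 < u" "u < 1" and ab: "0 \<le> a" "0 \<le> b"
  shows "(u * a + (1 - u) * b) powr q \<le> u * a powr q + (1 - u) * b powr q"
proof -
  have *: "(v * c) powr q \<le> v * c powr q" if "0 < v" "v < 1" "0 \<le> c" for v c :: real
  proof -
    have "v powr q \<le> v powr 1"
      using that q by (intro powr_mono') auto
    then show ?thesis
      using that by (simp add: powr_mult mult_right_mono)
  qed
  \<comment> \<open>Convexity of \<open>powr\<close> is invoked for positive arguments. If one of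
    them vanishes, the claim reduces to \<open>v powr q \<le> v\<close> for a weight
    \<open>v\<close> in (0,1).\<close>
  consider "a = 0" | "b = 0" | "0 < a" "0 < b"
    using ab by linarith
  then show ?thesis
  proof cases
    case 1
    then show ?thesis using *[of "1 - u" b] u ab q by simp
  next
    case 2
    then show ?thesis using *[of u a] u ab q by simp
  next
    case 3
    then show ?thesis
      using convex_onD[OF powr_convex[OF q], of "1 - u" a b] u by simp
  qed
qed

lemma one_le_enn2real: "1 \<le> p \<Longrightarrow> p \<noteq> \<infinity> \<Longrightarrow> 1 \<le> enn2real p"
  by (cases p) (auto simp flip: ennreal_1)

text \<open>The q-th power and the q-th root are mutually inverse monotone maps on the nonnegative
  reals. This removes the root and the case distinction from \<open>Lp_norm\<close>, so for finite
  \<open>p\<close> every norm estimate becomes an inequality between integrals.\<close>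

lemma Lp_norm_le_iff:
  assumes "1 \<le> p" "p \<noteq> \<infinity>" "0 \<le> c"
  shows "Lp_norm p f \<le> ennreal c \<longleftrightarrow>
    (\<integral>\<^sup>+x. ennreal (f x powr enn2real p) \<partial>lebesgue) \<le> ennreal (c powr enn2real p)"
proof -
  let ?I = "\<integral>\<^sup>+x. ennreal (f x powr enn2real p) \<partial>lebesgue"
  define q where "q = enn2real p"
  have q: "1 \<le> q"
    using assms unfolding q_def by (simp add: one_le_enn2real)
  show ?thesis
  proof (cases "?I = \<infinity>")
    case True
    then show ?thesis
      using assms by (simp add: Lp_norm_def top_unique)
  next
    case False
    then obtain i where i: "?I = ennreal i" "0 \<le> i"
      by (cases ?I) auto
    have "i powr (1 / q) \<le> c \<longleftrightarrow> i \<le> c powr q"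
    proof
      assume "i powr (1 / q) \<le> c"
      then have "(i powr (1 / q)) powr q \<le> c powr q"
        using q by (intro powr_mono2) auto
      then show "i \<le> c powr q" using i q by (simp add: powr_powr)
    next
      assume "i \<le> c powr q"
      then have "i powr (1 / q) \<le> (c powr q) powr (1 / q)"
        using q i by (intro powr_mono2) auto
      then show "i powr (1 / q) \<le> c" using assms q by (simp add: powr_powr)
    qed
    then show ?thesis
      using assms i unfolding Lp_norm_def by (simp add: ennreal_le_iff q_def)
  qed
qed

lemma Lp_norm_top_le_iff:
  assumes "f \<in> borel_measurable lebesgue" "0 \<le> c"
  shows "Lp_norm \<infinity> f \<le> ennreal c \<longleftrightarrow> (AE x in lebesgue. f x \<le> c)"
proof
  assume "Lp_norm \<infinity> f \<le> ennreal c"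
  then have "AE x in lebesgue. ennreal (f x) \<le> ennreal c"
    using esssup_AE[of "\<lambda>x. ennreal (f x)" lebesgue]
    by (auto simp: Lp_norm_def elim!: order_trans)
  then show "AE x in lebesgue. f x \<le> c"
    using assms by (simp add: ennreal_le_iff)
next
  assume "AE x in lebesgue. f x \<le> c"
  then show "Lp_norm \<infinity> f \<le> ennreal c"
    using assms unfolding Lp_norm_def by (auto intro!: esssup_I ennreal_leI)
qed

text \<open>The smaller function is required to be measurable because \<open>esssup\<close> assigns
  the value infinity to a non-measurable argument.\<close>

lemma Lp_norm_mono:
  assumes "1 \<le> p" "f \<in> borel_measurable lebesgue" "AE x in lebesgue. 0 \<le> f x \<and> f x \<le> g x"
  shows "Lp_norm p f \<le> Lp_norm p g"
proof (cases "p = \<infinity>")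
  case True
  show ?thesis
    unfolding Lp_norm_def True using assms by (auto intro!: esssup_AE_mono ennreal_leI)
next
  case False
  have "Lp_norm p f \<le> ennreal c" if "Lp_norm p g \<le> ennreal c" "0 \<le> c" for c
  proof -
    have "(\<integral>\<^sup>+x. ennreal (f x powr enn2real p) \<partial>lebesgue) \<le>
        (\<integral>\<^sup>+x. ennreal (g x powr enn2real p) \<partial>lebesgue)"
      using assms by (intro nn_integral_mono_AE) (auto intro!: ennreal_leI powr_mono2)
    with that show ?thesis
      using Lp_norm_le_iff[OF assms(1) False that(2), of f]
        Lp_norm_le_iff[OF assms(1) False that(2), of g] by auto
  qed
  then show ?thesis
    by (cases "Lp_norm p g") auto
qed

lemma Lp_norm_cmult:
  assumes "1 \<le> p" "f \<in> borel_measurable lebesgue" "\<And>x. 0 \<le> f x" "0 < c"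
  shows "Lp_norm p (\<lambda>x. c * f x) \<le> ennreal c * Lp_norm p f"
proof (cases "Lp_norm p f = \<infinity>")
  case True
  then show ?thesis using assms by (simp add: ennreal_mult_top)
next
  case False
  then obtain m where m: "Lp_norm p f = ennreal m" "0 \<le> m"
    by (cases "Lp_norm p f") auto
  have "Lp_norm p (\<lambda>x. c * f x) \<le> ennreal (c * m)"
  proof (cases "p = \<infinity>")
    case True
    then have "AE x in lebesgue. f x \<le> m"
      using Lp_norm_top_le_iff m assms by (metis order_refl)
    then have "AE x in lebesgue. c * f x \<le> c * m"
      using assms by auto
    then show ?thesis
      using assms m True by (subst True, subst Lp_norm_top_le_iff) auto
  next
    case False
    have "(\<integral>\<^sup>+x. ennreal ((c * f x) powr enn2real p) \<partial>lebesgue) =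
        ennreal (c powr enn2real p) * (\<integral>\<^sup>+x. ennreal (f x powr enn2real p) \<partial>lebesgue)"
      using assms by (subst nn_integral_cmult[symmetric]) (auto simp: powr_mult ennreal_mult)
    also have "\<dots> \<le> ennreal (c powr enn2real p) * ennreal (m powr enn2real p)"
      using Lp_norm_le_iff[OF assms(1) False m(2), of f] m by (intro mult_left_mono) auto
    also have "\<dots> = ennreal ((c * m) powr enn2real p)"
      using assms m by (simp add: powr_mult ennreal_mult)
    finally show ?thesis
      using Lp_norm_le_iff[OF assms(1) False, of "c * m" "\<lambda>x. c * f x"] assms m by simp
  qed
  then show ?thesis using m assms by (simp add: ennreal_mult)
qed

lemma Lp_norm_add:
  assumes p: "1 \<le> p"
    and [measurable]: "f \<in> borel_measurable lebesgue" "g \<in> borel_measurable lebesgue"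
    and nonneg: "\<And>x. 0 \<le> f x" "\<And>x. 0 \<le> g x"
  shows "Lp_norm p (\<lambda>x. f x + g x) \<le> Lp_norm p f + Lp_norm p g"
proof (cases "Lp_norm p f = \<infinity> \<or> Lp_norm p g = \<infinity>")
  case True
  then show ?thesis by auto
next
  case False
  then obtain m n where m: "Lp_norm p f = ennreal m" "0 \<le> m"
    and n: "Lp_norm p g = ennreal n" "0 \<le> n"
    by (cases "Lp_norm p f"; cases "Lp_norm p g") auto
  show ?thesis
  proof (cases "p = \<infinity>")
    case True
    then have "AE x in lebesgue. f x \<le> m" "AE x in lebesgue. g x \<le> n"
      using Lp_norm_top_le_iff m n assms(2,3) by (metis order_refl)+
    then have "AE x in lebesgue. f x + g x \<le> m + n" by eventually_elim simp
    then have "Lp_norm \<infinity> (\<lambda>x. f x + g x) \<le> ennreal (m + n)"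
      using m n by (subst Lp_norm_top_le_iff) auto
    then show ?thesis using True m n by simp
  next
    case False
    define q where "q = enn2real p"
    have q: "1 \<le> q"
      using p False unfolding q_def by (simp add: one_le_enn2real)
    have "Lp_norm p (\<lambda>x. f x + g x) \<le> ennreal (m + n) + ennreal e" if "0 < e" for e
    proof -
      \<comment> \<open>Convexity with weights proportional to the norms; \<open>e\<close> keeps the weights positive.\<close>
      define a b s where "a = m + e / 2" and "b = n + e / 2" and "s = a + b"
      have ab: "0 < a" "0 < b" using that m n by (auto simp: a_def b_def)
      define u where "u = a / s"
      have u: "0 < u" "u < 1" "1 - u = b / s" using ab by (auto simp: u_def s_def field_simps)
      have f: "(\<integral>\<^sup>+x. ennreal (f x powr q) \<partial>lebesgue) \<le> ennreal (a powr q)"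
        using m that Lp_norm_le_iff[OF p False, of a f] by (auto simp: q_def a_def intro: ennreal_leI)
      have g: "(\<integral>\<^sup>+x. ennreal (g x powr q) \<partial>lebesgue) \<le> ennreal (b powr q)"
        using n that Lp_norm_le_iff[OF p False, of b g] by (auto simp: q_def b_def intro: ennreal_leI)
      \<comment> \<open>The convex combination is formed from the rescaled functions
        \<open>(s / a) * f\<close> and \<open>(s / b) * g\<close>, whose norms are at most
        \<open>s\<close>. \<open>P\<close> and \<open>Q\<close> collect the weights and the scaling
        factors, so that \<open>P * a powr q + Q * b powr q\<close> is exactly
        \<open>s powr q\<close>.\<close>
      define P Q where "P = u * (s / a) powr q" and "Q = (1 - u) * (s / b) powr q"
      have PQ: "0 \<le> P" "0 \<le> Q" using u(1,2) by (auto simp: P_def Q_def)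
      have pt: "(f x + g x) powr q \<le> P * f x powr q + Q * g x powr q" for x
      proof -
        have "f x + g x = u * ((s / a) * f x) + (1 - u) * ((s / b) * g x)"
          using ab u(3) by (simp add: u_def s_def)
        also have "\<dots> powr q \<le> u * ((s / a) * f x) powr q + (1 - u) * ((s / b) * g x) powr q"
          using ab nonneg[of x] by (intro powr_convex_combination q u) (auto simp: s_def)
        finally show ?thesis by (simp only: powr_mult P_def Q_def mult.assoc)
      qed
      have "(\<integral>\<^sup>+x. ennreal ((f x + g x) powr q) \<partial>lebesgue)
          \<le> (\<integral>\<^sup>+x. ennreal P * ennreal (f x powr q) + ennreal Q * ennreal (g x powr q) \<partial>lebesgue)"
        using PQ pt by (intro nn_integral_mono) (simp add: ennreal_leI flip: ennreal_mult ennreal_plus)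
      also have "\<dots> = ennreal P * (\<integral>\<^sup>+x. ennreal (f x powr q) \<partial>lebesgue)
            + ennreal Q * (\<integral>\<^sup>+x. ennreal (g x powr q) \<partial>lebesgue)"
        by (simp add: nn_integral_add nn_integral_cmult)
      also have "\<dots> \<le> ennreal P * ennreal (a powr q) + ennreal Q * ennreal (b powr q)"
        by (intro add_mono mult_left_mono f g) auto
      also have "\<dots> = ennreal (P * a powr q + Q * b powr q)"
        using PQ by (simp add: ennreal_mult)
      also have "P * a powr q + Q * b powr q = s powr q"
      proof -
        have "(s / c) powr q * c powr q = s powr q" if "0 < c" for c
          by (subst powr_mult[symmetric]) (use that in simp)
        from this[OF ab(1)] this[OF ab(2)]
        have "P * a powr q = u * s powr q" "Q * b powr q = (1 - u) * s powr q"
          unfolding P_def Q_def mult.assoc by simp_all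
        then show ?thesis by (simp add: left_diff_distrib)
      qed
      finally have "Lp_norm p (\<lambda>x. f x + g x) \<le> ennreal s"
        using Lp_norm_le_iff[OF p False, of s "\<lambda>x. f x + g x"] ab by (simp add: s_def q_def)
      also have "s = (m + n) + e" by (simp add: s_def a_def b_def)
      also have "ennreal \<dots> = ennreal (m + n) + ennreal e"
        using m(2) n(2) that by (intro ennreal_plus) auto
      finally show ?thesis .
    qed
    then have "Lp_norm p (\<lambda>x. f x + g x) \<le> ennreal (m + n)"
      by (rule ennreal_le_epsilon)
    then show ?thesis
      unfolding m(1) n(1) ennreal_plus[OF m(2) n(2)] .
  qed
qed

lemma Lp_norm_zero: "1 \<le> p \<Longrightarrow> Lp_norm p (\<lambda>x. 0) = 0"
proof (cases "p = \<infinity>")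
  case True
  then show ?thesis
    using Lp_norm_top_le_iff[of "\<lambda>x. 0" 0] by simp
qed (use Lp_norm_le_iff[of p 0 "\<lambda>x. 0"] in simp)

lemma Lp_norm_eq_zero:
  assumes p: "1 \<le> p" and [measurable]: "f \<in> borel_measurable lebesgue" and "\<And>x. 0 \<le> f x"
    and zero: "Lp_norm p f = 0"
  shows "AE x in lebesgue. f x = 0"
proof (cases "p = \<infinity>")
  case True
  then have "AE x in lebesgue. f x \<le> 0"
    using Lp_norm_top_le_iff[of f 0] zero by simp
  then show ?thesis by eventually_elim (simp add: antisym assms(3))
next
  case False
  then have "(\<integral>\<^sup>+x. ennreal (f x powr enn2real p) \<partial>lebesgue) = 0"
    using Lp_norm_le_iff[OF p False, of 0 f] zero by simp
  then have "AE x in lebesgue. ennreal (f x powr enn2real p) = 0"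
    by (subst (asm) nn_integral_0_iff_AE) auto
  then show ?thesis by eventually_elim (auto simp: ennreal_eq_0_iff)
qed

lemma Lp_norm_sum:
  fixes n :: nat
  assumes "1 \<le> p" "\<And>k. f k \<in> borel_measurable lebesgue" "\<And>k x. 0 \<le> f k x"
  shows "Lp_norm p (\<lambda>x. \<Sum>k<n. f k x) \<le> (\<Sum>k<n. Lp_norm p (f k))"
proof (induction n)
  case 0
  then show ?case using assms by (simp add: Lp_norm_zero)
next
  case (Suc n)
  have "Lp_norm p (\<lambda>x. \<Sum>k<Suc n. f k x) \<le> Lp_norm p (\<lambda>x. \<Sum>k<n. f k x) + Lp_norm p (f n)"
    using assms by (auto intro!: Lp_norm_add sum_nonneg borel_measurable_sum)
  with Suc show ?case by (auto intro: order_trans add_right_mono)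
qed

text \<open>All partial sums have norm at most the sum of \<open>m\<close>. For
  \<open>p = \<infinity>\<close> the countably many exceptional null sets are merged; for finite
  \<open>p\<close> monotone convergence is used. A.e. summability is part of the conclusion because
  the real-valued \<open>suminf\<close> carries information only at points of convergence.\<close>

lemma Lp_norm_suminf:
  fixes f :: "nat \<Rightarrow> 'a::euclidean_space \<Rightarrow> real"
  assumes p: "1 \<le> p" and [measurable]: "\<And>k. f k \<in> borel_measurable lebesgue"
    and nonneg: "\<And>k x. 0 \<le> f k x"
    and bound: "\<And>k. Lp_norm p (f k) \<le> ennreal (m k)" "\<And>k. 0 \<le> m k" "summable m"
  shows "AE x in lebesgue. summable (\<lambda>k. f k x)"
    and "Lp_norm p (\<lambda>x. \<Sum>k. f k x) \<le> ennreal (\<Sum>k. m k)"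
proof -
  define M where "M = (\<Sum>k. m k)"
  have M: "0 \<le> M" using bound by (simp add: M_def suminf_nonneg)
  let ?s = "\<lambda>n x. \<Sum>k<n. f k x"
  have part: "Lp_norm p (?s n) \<le> ennreal M" for n
  proof -
    have "Lp_norm p (?s n) \<le> (\<Sum>k<n. ennreal (m k))"
      using assms by (intro order_trans[OF Lp_norm_sum] sum_mono) auto
    also have "\<dots> = ennreal (\<Sum>k<n. m k)" using bound by (simp add: sum_ennreal)
    also have "\<dots> \<le> ennreal M"
      unfolding M_def using bound by (intro ennreal_leI sum_le_suminf) auto
    finally show ?thesis .
  qed
  have summableI: "summable (\<lambda>k. f k x)" if "\<And>n. ?s n x \<le> c" for x c
    using that nonneg by (intro summableI_nonneg_bounded) auto
  have "(AE x in lebesgue. summable (\<lambda>k. f k x)) \<and> Lp_norm p (\<lambda>x. \<Sum>k. f k x) \<le> ennreal M"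
  proof (cases "p = \<infinity>")
    case True
    have "AE x in lebesgue. \<forall>n. ?s n x \<le> M"
      unfolding AE_all_countable using part Lp_norm_top_le_iff[of "?s _" M] M True by simp
    then have "AE x in lebesgue. summable (\<lambda>k. f k x) \<and> (\<Sum>k. f k x) \<le> M"
      by eventually_elim (auto intro!: summableI suminf_le_const)
    then show ?thesis
      using True M Lp_norm_top_le_iff[of "\<lambda>x. \<Sum>k. f k x" M] by simp
  next
    case False
    define q where "q = enn2real p"
    have q: "1 \<le> q"
      using p False unfolding q_def by (simp add: one_le_enn2real)
    \<comment> \<open>The supremum is taken in the extended reals, where it exists before
      convergence is known. Its finite integral makes it finite a.e., and that bounds the real
      partial sums.\<close>
    define L where "L = (\<lambda>x. SUP n. ennreal (?s n x powr q))"
    have [measurable]: "L \<in> borel_measurable lebesgue" by (simp add: L_def)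
    have "incseq (\<lambda>n x. ennreal (?s n x powr q))"
      using nonneg q
      by (intro monoI le_funI ennreal_leI powr_mono2 sum_mono2) (auto intro: sum_nonneg)
    then have "(\<integral>\<^sup>+x. L x \<partial>lebesgue) = (SUP n. \<integral>\<^sup>+x. ennreal (?s n x powr q) \<partial>lebesgue)"
      unfolding L_def by (intro nn_integral_monotone_convergence_SUP) auto
    also have "\<dots> \<le> ennreal (M powr q)"
      using part Lp_norm_le_iff[OF p False M, of "?s _"] by (intro SUP_least) (simp add: q_def)
    finally have L: "(\<integral>\<^sup>+x. L x \<partial>lebesgue) \<le> ennreal (M powr q)" .
    then have "AE x in lebesgue. L x \<noteq> \<infinity>"
      by (intro nn_integral_PInf_AE) (auto simp: top_unique)
    then have ae: "AE x in lebesgue. summable (\<lambda>k. f k x) \<and>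
        ennreal ((\<Sum>k. f k x) powr q) \<le> L x"
    proof eventually_elim
      case (elim x)
      then obtain c where c: "L x = ennreal c" "0 \<le> c" by (cases "L x") auto
      have s: "?s n x \<le> c powr (1 / q)" for n
      proof -
        have "ennreal (?s n x powr q) \<le> ennreal c"
          unfolding c(1)[symmetric] L_def by (rule SUP_upper) simp
        then have "?s n x powr q \<le> c" using c by (simp add: ennreal_le_iff)
        then have "(?s n x powr q) powr (1 / q) \<le> c powr (1 / q)"
          using q by (intro powr_mono2) auto
        then show ?thesis using q nonneg by (simp add: powr_powr sum_nonneg)
      qed
      have "(\<Sum>k. f k x) \<le> c powr (1 / q)"
        using s by (intro suminf_le_const summableI)
      then have "(\<Sum>k. f k x) powr q \<le> (c powr (1 / q)) powr q"
        using q nonneg s by (intro powr_mono2 suminf_nonneg summableI) auto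
      then have "(\<Sum>k. f k x) powr q \<le> c" using q c by (simp add: powr_powr)
      then show ?case using s c by (auto intro: summableI ennreal_leI)
    qed
    have "(\<integral>\<^sup>+x. ennreal ((\<Sum>k. f k x) powr q) \<partial>lebesgue) \<le> (\<integral>\<^sup>+x. L x \<partial>lebesgue)"
      using ae by (intro nn_integral_mono_AE) auto
    also note L
    finally show ?thesis
      using ae Lp_norm_le_iff[OF p False M, of "\<lambda>x. \<Sum>k. f k x"] by (auto simp: q_def)
  qed
  then show "AE x in lebesgue. summable (\<lambda>k. f k x)"
    "Lp_norm p (\<lambda>x. \<Sum>k. f k x) \<le> ennreal (\<Sum>k. m k)"
    by (auto simp: M_def)
qed

subsection \<open>Norms on Euclidean space\<close>

lemma is_normD:
  assumes "is_norm N"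
  shows "0 \<le> N v" "N 0 = 0" "N v = 0 \<longleftrightarrow> v = 0" "N (c *\<^sub>R v) = \<bar>c\<bar> * N v"
    "N (v + w) \<le> N v + N w" "N (- v) = N v"
proof -
  show *: "0 \<le> N v" "N 0 = 0" "N v = 0 \<longleftrightarrow> v = 0" "N (v + w) \<le> N v + N w"
    using assms unfolding is_norm_def by blast+
  show scale: "N (c *\<^sub>R v) = \<bar>c\<bar> * N v" for c
    using assms unfolding is_norm_def by blast
  show "N (- v) = N v" using scale[of "-1"] by simp
qed

lemma is_norm_upper_bound:
  fixes N :: "'b::euclidean_space \<Rightarrow> real"
  assumes "is_norm N"
  obtains C where "0 \<le> C" "\<And>v. N v \<le> C * norm v"
proof
  show "0 \<le> (\<Sum>b\<in>Basis. N b)" using assms by (simp add: sum_nonneg is_normD)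
  fix v :: 'b
  have sum: "N (\<Sum>i\<in>A. f i) \<le> (\<Sum>i\<in>A. N (f i))" if "finite A" for A and f :: "'b \<Rightarrow> 'b"
    using that
    by (induction A) (auto simp: is_normD[OF assms] intro: order_trans[OF is_normD(5)[OF assms]])
  have "N v = N (\<Sum>b\<in>Basis. (v \<bullet> b) *\<^sub>R b)" by (simp add: euclidean_representation)
  also have "\<dots> \<le> (\<Sum>b\<in>Basis. N ((v \<bullet> b) *\<^sub>R b))" by (rule sum) simp
  also have "\<dots> \<le> (\<Sum>b\<in>Basis. norm v * N b)"
    by (intro sum_mono) (auto simp: is_normD[OF assms] Basis_le_norm intro!: mult_right_mono)
  finally show "N v \<le> (\<Sum>b\<in>Basis. N b) * norm v"
    by (simp add: sum_distrib_left mult.commute)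
qed

text \<open>Stated for a general function \<open>f\<close> because it serves twice: for
  \<open>N\<close> itself and for the \<open>N\<close>-distance to a fixed set. The upper bound on
  \<open>N\<close> turns it into Euclidean Lipschitz continuity.\<close>

lemma continuous_on_if_norm_nonexpansive:
  fixes N :: "'b::euclidean_space \<Rightarrow> real"
  assumes "is_norm N" "\<And>v w. f v \<le> f w + N (v - w)"
  shows "continuous_on A f"
proof -
  obtain C where C: "0 \<le> C" "\<And>v. N v \<le> C * norm v"
    using is_norm_upper_bound assms(1) by blast
  have "C-lipschitz_on A f"
  proof (rule lipschitz_onI)
    fix v w
    have "f v - f w \<le> C * norm (v - w)" "f w - f v \<le> C * norm (w - v)"
      using assms(2)[of v w] assms(2)[of w v] C(2)[of "v - w"] C(2)[of "w - v"] by linarith+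
    then show "dist (f v) (f w) \<le> C * dist v w"
      by (simp add: dist_norm norm_minus_commute abs_le_iff)
  qed (fact C)
  then show ?thesis by (rule lipschitz_on_continuous_on)
qed

lemma is_norm_continuous_on:
  fixes N :: "'b::euclidean_space \<Rightarrow> real"
  assumes "is_norm N"
  shows "continuous_on A N"
  using is_normD(5)[OF assms, of "_ - _"]
  by (intro continuous_on_if_norm_nonexpansive[OF assms])
    (metis add.commute diff_add_cancel)

text \<open>The constant is the minimum of \<open>N\<close> on the compact Euclidean unit sphere. It
  lets a bound in \<open>N\<close> imply Euclidean boundedness, which membership in
  \<open>K_bcs\<close> requires.\<close>

lemma is_norm_lower_bound:
  fixes N :: "'b::euclidean_space \<Rightarrow> real"
  assumes "is_norm N"
  obtains c where "0 < c" "\<And>v. c * norm v \<le> N v"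
proof -
  obtain u :: 'b where u: "norm u = 1" using vector_choose_size zero_le_one by blast
  have "compact (sphere 0 1 :: 'b set)" "sphere 0 1 \<noteq> ({} :: 'b set)"
    using u by (auto intro!: exI[of _ u])
  then obtain w where w: "w \<in> sphere 0 1" "\<And>v. v \<in> sphere 0 1 \<Longrightarrow> N w \<le> N v"
    using continuous_attains_inf[OF _ _ is_norm_continuous_on[OF assms]] by metis
  have "N w * norm v \<le> N v" for v
  proof (cases "v = 0")
    case False
    have "N w \<le> N (v /\<^sub>R norm v)" using False by (intro w) simp
    then show ?thesis
      using False by (simp add: is_normD(4)[OF assms] field_simps)
  qed (simp add: is_normD[OF assms])
  moreover have "N w > 0"
    using w(1) is_normD(1,3)[OF assms, of w] by (metis less_eq_real_def norm_zero zero_neq_one mem_sphere_0)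
  ultimately show ?thesis using that by blast
qed

subsection \<open>Symmetric convex bodies and the Hausdorff distance\<close>

lemma K_bcs_nonempty: "K \<in> K_bcs \<Longrightarrow> K \<noteq> {}"
  and K_bcs_compact: "K \<in> K_bcs \<Longrightarrow> compact K"
  and K_bcs_convex: "K \<in> K_bcs \<Longrightarrow> convex K"
  and K_bcs_uminus: "K \<in> K_bcs \<Longrightarrow> v \<in> K \<Longrightarrow> - v \<in> K"
  unfolding K_bcs_def by (auto simp: compact_eq_bounded_closed)

lemma K_bcsI:
  assumes "K \<noteq> {}" "compact K" "convex K" "\<And>v. v \<in> K \<Longrightarrow> - v \<in> K"
  shows "K \<in> K_bcs"
  using assms unfolding K_bcs_def compact_eq_bounded_closed
  by (auto simp: image_iff) (metis minus_minus)

lemma zero_in_K_bcs: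
  assumes "K \<in> K_bcs"
  shows "0 \<in> K"
proof -
  obtain v where v: "v \<in> K" using K_bcs_nonempty assms by blast
  then have "(1/2) *\<^sub>R v + (1/2) *\<^sub>R (- v) \<in> K"
    using K_bcs_uminus assms by (intro convexD[OF K_bcs_convex[OF assms]]) auto
  then show ?thesis by simp
qed

lemma K_bcs_singleton_zero: "{0} \<in> K_bcs"
  by (intro K_bcsI) auto

lemma K_bcs_plus:
  assumes "K \<in> K_bcs" "L \<in> K_bcs"
  shows "K + L \<in> K_bcs"
proof (rule K_bcsI)
  show "K + L \<noteq> {}"
    using zero_in_K_bcs[OF assms(1)] zero_in_K_bcs[OF assms(2)] by (auto simp: set_plus_def)
  have "K + L = (\<Union>v\<in>K. \<Union>w\<in>L. {v + w})" by (auto simp: set_plus_def)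
  then show "compact (K + L)" using compact_sums'[OF assms[THEN K_bcs_compact]] by simp
  show "convex (K + L)" using assms by (intro convex_set_plus K_bcs_convex)
  show "- v \<in> K + L" if v: "v \<in> K + L" for v
  proof -
    obtain a b where "v = a + b" "a \<in> K" "b \<in> L" using v by (rule set_plus_elim)
    then have "- a + - b \<in> K + L"
      using K_bcs_uminus assms by (intro set_plus_intro)
    then show ?thesis using \<open>v = a + b\<close> by simp
  qed
qed

lemma K_bcs_scale:
  assumes "K \<in> K_bcs"
  shows "(*\<^sub>R) c ` K \<in> K_bcs"
proof (rule K_bcsI)
  show "- v \<in> (*\<^sub>R) c ` K" if "v \<in> (*\<^sub>R) c ` K" for v
    using that K_bcs_uminus[OF assms]
    by (auto simp: image_iff) (metis scaleR_minus_right)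
qed (use assms in \<open>auto intro!: compact_scaling convex_scaling simp: K_bcs_nonempty K_bcs_compact K_bcs_convex\<close>)

lemma K_bcs_sum:
  fixes n :: nat
  assumes "\<And>k. A k \<in> K_bcs"
  shows "(\<Sum>k<n. A k) \<in> K_bcs"
  by (induction n) (auto simp: K_bcs_singleton_zero K_bcs_plus assms)

text \<open>Nestedness is what makes the union convex: any two of its points lie in a common
  \<open>K n\<close>. Symmetry passes to the closure by continuity of negation.\<close>

lemma K_bcs_closure_Union:
  assumes K: "\<And>n. K n \<in> K_bcs" and mono: "incseq K" and "bounded (\<Union>n. K n)"
  shows "closure (\<Union>n. K n) \<in> K_bcs"
proof (rule K_bcsI)
  let ?U = "\<Union>n. K n"
  show "closure ?U \<noteq> {}" using K_bcs_nonempty[OF K] by auto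
  show "compact (closure ?U)" using assms by (simp add: compact_closure)
  have "convex ?U"
  proof (rule convexI)
    fix a b and u v :: real
    assume "a \<in> ?U" "b \<in> ?U" and uv: "0 \<le> u" "0 \<le> v" "u + v = 1"
    then obtain m n where "a \<in> K m" "b \<in> K n" by auto
    moreover have "K m \<subseteq> K (max m n)" "K n \<subseteq> K (max m n)"
      using incseqD[OF mono] by simp_all
    ultimately have "a \<in> K (max m n)" "b \<in> K (max m n)" by auto
    then have "u *\<^sub>R a + v *\<^sub>R b \<in> K (max m n)"
      using uv by (intro convexD[OF K_bcs_convex[OF K]])
    then show "u *\<^sub>R a + v *\<^sub>R b \<in> ?U" by blast
  qed
  then show "convex (closure ?U)" by (rule convex_closure)
  show "- v \<in> closure ?U" if "v \<in> closure ?U" for v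
  proof -
    have "uminus ` closure ?U \<subseteq> closure ?U"
      using K_bcs_uminus[OF K] closure_subset[of ?U]
      by (intro image_closure_subset continuous_intros) auto
    then show ?thesis using that by blast
  qed
qed

text \<open>A real-valued \<open>SUP\<close> is informative only over a nonempty bounded set;
  compactness of \<open>K\<close> and continuity of \<open>N\<close> provide the bound, and the
  origin in \<open>K\<close> gives nonnegativity.\<close>

lemma
  fixes K :: "'b::euclidean_space set"
  assumes "is_norm N" "K \<in> K_bcs"
  shows set_norm_upper: "v \<in> K \<Longrightarrow> N v \<le> set_norm N K"
    and set_norm_le_iff: "set_norm N K \<le> c \<longleftrightarrow> (\<forall>v\<in>K. N v \<le> c)"
    and set_norm_nonneg: "0 \<le> set_norm N K"
proof -
  have *: "bdd_above (N ` K)"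
    using assms by (intro bounded_imp_bdd_above compact_imp_bounded compact_continuous_image
        is_norm_continuous_on K_bcs_compact)
  show **: "v \<in> K \<Longrightarrow> N v \<le> set_norm N K" for v
    unfolding set_norm_def using * by (rule cSUP_upper2) auto
  show "set_norm N K \<le> c \<longleftrightarrow> (\<forall>v\<in>K. N v \<le> c)"
    unfolding set_norm_def using * K_bcs_nonempty[OF assms(2)] by (simp add: cSUP_le_iff)
  show "0 \<le> set_norm N K"
    using **[OF zero_in_K_bcs[OF assms(2)]] is_normD(2)[OF assms(1)] by simp
qed

text \<open>The infimum over the compact set \<open>L\<close> is attained, so a non-strict bound
  comes with an exact witness. The later arguments with the Hausdorff distance are free of epsilons
  for this reason.\<close>

lemma INF_norm_diff_le_iff:
  fixes L :: "'b::euclidean_space set"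
  assumes "is_norm N" "L \<in> K_bcs"
  shows "(INF w\<in>L. N (v - w)) \<le> c \<longleftrightarrow> (\<exists>w\<in>L. N (v - w) \<le> c)"
proof -
  have "continuous_on L (\<lambda>w. N (v - w))"
    by (intro continuous_on_compose2[OF is_norm_continuous_on[OF assms(1), of UNIV]]
        continuous_intros) auto
  then obtain w where w: "w \<in> L" "\<And>u. u \<in> L \<Longrightarrow> N (v - w) \<le> N (v - u)"
    using continuous_attains_inf K_bcs_compact[OF assms(2)] K_bcs_nonempty[OF assms(2)] by metis
  then have "(INF w\<in>L. N (v - w)) = N (v - w)"
    by (intro cInf_eq_minimum) auto
  then show ?thesis using w by (auto intro: order_trans)
qed

lemma SUP_INF_norm_diff_le_iff:
  fixes K L :: "'b::euclidean_space set"
  assumes "is_norm N" "K \<in> K_bcs" "L \<in> K_bcs"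
  shows "(SUP v\<in>K. INF w\<in>L. N (v - w)) \<le> c \<longleftrightarrow> (\<forall>v\<in>K. \<exists>w\<in>L. N (v - w) \<le> c)"
proof -
  \<comment> \<open>The origin of \<open>L\<close> is a competitor, so the distance from
    \<open>v\<close> to \<open>L\<close> is at most \<open>N v\<close>. This bounds the outer
    supremum.\<close>
  have "(INF w\<in>L. N (v - w)) \<le> set_norm N K" if "v \<in> K" for v
    using INF_norm_diff_le_iff[OF assms(1,3)] zero_in_K_bcs[OF assms(3)]
      set_norm_upper[OF assms(1,2) that] by (metis diff_zero)
  then have "bdd_above ((\<lambda>v. INF w\<in>L. N (v - w)) ` K)"
    by (intro bdd_aboveI2)
  then show ?thesis
    using K_bcs_nonempty[OF assms(2)] INF_norm_diff_le_iff[OF assms(1,3)]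
    by (simp add: cSUP_le_iff)
qed

lemma hausdorff_dist_le_iff:
  fixes K L :: "'b::euclidean_space set"
  assumes "is_norm N" "K \<in> K_bcs" "L \<in> K_bcs"
  shows "hausdorff_dist N K L \<le> c \<longleftrightarrow>
    (\<forall>v\<in>K. \<exists>w\<in>L. N (v - w) \<le> c) \<and> (\<forall>v\<in>L. \<exists>w\<in>K. N (v - w) \<le> c)"
  unfolding hausdorff_dist_def using assms by (simp add: SUP_INF_norm_diff_le_iff)

lemma hausdorff_dist_commute: "hausdorff_dist N K L = hausdorff_dist N L K"
  unfolding hausdorff_dist_def by (rule max.commute)

lemma hausdorff_dist_nonneg:
  fixes K L :: "'b::euclidean_space set"
  assumes "is_norm N" "K \<in> K_bcs" "L \<in> K_bcs"
  shows "0 \<le> hausdorff_dist N K L"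
proof -
  obtain w where "N (0 - w) \<le> hausdorff_dist N K L"
    using hausdorff_dist_le_iff[OF assms, of "hausdorff_dist N K L"] zero_in_K_bcs[OF assms(2)] by blast
  then show ?thesis using is_normD(1)[OF assms(1), of "0 - w"] by linarith
qed

lemma hausdorff_dist_eq_zero:
  fixes K L :: "'b::euclidean_space set"
  assumes "is_norm N" "K \<in> K_bcs" "L \<in> K_bcs" "hausdorff_dist N K L = 0"
  shows "K = L"
proof -
  have *: "v = w" if "N (v - w) \<le> 0" for v w
    using is_normD(1,3)[OF assms(1), of "v - w"] that by (simp add: order_antisym)
  have "\<forall>v\<in>K. \<exists>w\<in>L. N (v - w) \<le> 0" "\<forall>v\<in>L. \<exists>w\<in>K. N (v - w) \<le> 0"
    using hausdorff_dist_le_iff[OF assms(1-3), of 0] assms(4) by simp_all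
  then show ?thesis using * by blast
qed

lemma hausdorff_dist_triangle:
  fixes K L M :: "'b::euclidean_space set"
  assumes N: "is_norm N" and K: "K \<in> K_bcs" and L: "L \<in> K_bcs" and M: "M \<in> K_bcs"
  shows "hausdorff_dist N K M \<le> hausdorff_dist N K L + hausdorff_dist N L M"
proof -
  have tri: "N (v - u) \<le> a + b" if "N (v - w) \<le> a" "N (w - u) \<le> b" for u v w a b
    using is_normD(5)[OF N, of "v - w" "w - u"] that by simp
  have KL: "(\<forall>v\<in>K. \<exists>w\<in>L. N (v - w) \<le> hausdorff_dist N K L) \<and>
      (\<forall>v\<in>L. \<exists>w\<in>K. N (v - w) \<le> hausdorff_dist N K L)"
    using hausdorff_dist_le_iff[OF N K L] by blast
  have LM: "(\<forall>v\<in>L. \<exists>w\<in>M. N (v - w) \<le> hausdorff_dist N L M) \<and>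
      (\<forall>v\<in>M. \<exists>w\<in>L. N (v - w) \<le> hausdorff_dist N L M)"
    using hausdorff_dist_le_iff[OF N L M] by blast
  show ?thesis
    unfolding hausdorff_dist_le_iff[OF N K M]
  proof (intro conjI ballI)
    fix v assume "v \<in> K"
    then obtain w u where "w \<in> L" "N (v - w) \<le> hausdorff_dist N K L"
      "u \<in> M" "N (w - u) \<le> hausdorff_dist N L M"
      using KL LM by blast
    then show "\<exists>u\<in>M. N (v - u) \<le> hausdorff_dist N K L + hausdorff_dist N L M"
      using tri by blast
  next
    fix v assume "v \<in> M"
    then obtain w u where "w \<in> L" "N (v - w) \<le> hausdorff_dist N L M"
      "u \<in> K" "N (w - u) \<le> hausdorff_dist N K L"
      using KL LM by blast
    then show "\<exists>u\<in>K. N (v - u) \<le> hausdorff_dist N K L + hausdorff_dist N L M"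
      using tri by (subst add.commute) blast
  qed
qed

subsection \<open>Measurability\<close>

lemma set_measurable_plus:
  assumes "set_measurable F" "set_measurable G"
  shows "set_measurable (\<lambda>x. F x + G x)"
  unfolding set_measurable_def
proof safe
  fix U :: "'b set" assume U: "open U"
  obtain B :: "'b set set" where B: "countable B" "topological_basis B"
    using ex_countable_basis by blast
  \<comment> \<open>That \<open>v + w\<close> lies in \<open>U\<close> is an open condition on the
    pair, so it is witnessed by a product of two basic open sets, and there are only countably many
    such products.\<close>
  let ?P = "{(b, c) \<in> B \<times> B. b + c \<subseteq> U}"
  have "{x. (F x + G x) \<inter> U \<noteq> {}} =
      (\<Union>(b, c)\<in>?P. {x. F x \<inter> b \<noteq> {}} \<inter> {x. G x \<inter> c \<noteq> {}})" (is "?L = ?R")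
  proof
    show "?L \<subseteq> ?R"
    proof
      fix x assume "x \<in> ?L"
      then obtain v w where vw: "v \<in> F x" "w \<in> G x" "v + w \<in> U" by (auto simp: set_plus_def)
      have "open ((\<lambda>z. fst z + snd z) -` U)"
        by (intro open_vimage U continuous_intros)
      then obtain V W where VW: "open V" "open W" "v \<in> V" "w \<in> W"
        "V \<times> W \<subseteq> (\<lambda>z. fst z + snd z) -` U"
        using vw(3) by (elim open_prod_elim[where x="(v, w)"]) auto
      obtain b c where "b \<in> B" "v \<in> b" "b \<subseteq> V" "c \<in> B" "w \<in> c" "c \<subseteq> W"
        using VW B(2) by (meson topological_basisE)
      moreover have "v + w \<in> U" if "v \<in> V" "w \<in> W" for v w
        using VW(5) that by (auto dest: subsetD[of _ _ "(v, w)"])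
      ultimately have "(b, c) \<in> ?P" by (auto simp: set_plus_def)
      with vw show "x \<in> ?R" using \<open>v \<in> b\<close> \<open>w \<in> c\<close> by blast
    qed
    show "?R \<subseteq> ?L" by (auto simp: set_plus_def)
  qed
  also have "\<dots> \<in> sets lebesgue"
  proof (rule sets.countable_UN'')
    show "countable ?P"
      by (rule countable_subset[OF _ countable_SIGMA[OF B(1) B(1)]]) auto
    show "(case z of (b, c) \<Rightarrow> {x. F x \<inter> b \<noteq> {}} \<inter> {x. G x \<inter> c \<noteq> {}}) \<in> sets lebesgue"
      if "z \<in> ?P" for z
      using that assms topological_basis_open[OF B(2)] by (auto simp: set_measurable_def)
  qed
  finally show "{x. (F x + G x) \<inter> U \<noteq> {}} \<in> sets lebesgue" .
qed

lemma set_measurable_scale: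
  assumes "set_measurable F"
  shows "set_measurable (\<lambda>x. (*\<^sub>R) c ` F x)"
  unfolding set_measurable_def
proof safe
  fix U :: "'b set" assume "open U"
  then have "open ((*\<^sub>R) c -` U)" by (intro open_vimage continuous_intros)
  moreover have "{x. (*\<^sub>R) c ` F x \<inter> U \<noteq> {}} = {x. F x \<inter> ((*\<^sub>R) c -` U) \<noteq> {}}" by auto
  ultimately show "{x. (*\<^sub>R) c ` F x \<inter> U \<noteq> {}} \<in> sets lebesgue"
    using assms by (simp add: set_measurable_def)
qed

lemma set_measurable_const: "set_measurable (\<lambda>x. K)"
  by (auto simp: set_measurable_def)

lemma set_measurable_sum:
  fixes n :: nat
  assumes "\<And>k. set_measurable (F k)"
  shows "set_measurable (\<lambda>x. \<Sum>k<n. F k x)"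
  by (induction n) (auto simp: set_measurable_const assms intro!: set_measurable_plus)

lemma set_measurable_closure_Union:
  fixes F :: "nat \<Rightarrow> 'a::euclidean_space \<Rightarrow> 'b::euclidean_space set"
  assumes "\<And>n. set_measurable (F n)"
  shows "set_measurable (\<lambda>x. closure (\<Union>n. F n x))"
  unfolding set_measurable_def
proof safe
  fix U :: "'b set" assume U: "open U"
  have "{x. closure (\<Union>n. F n x) \<inter> U \<noteq> {}} = (\<Union>n. {x. F n x \<inter> U \<noteq> {}})"
    using open_Int_closure_eq_empty[OF U] by (auto simp: Int_commute)
  also have "\<dots> \<in> sets lebesgue"
    using assms U by (auto simp: set_measurable_def)
  finally show "{x. closure (\<Union>n. F n x) \<inter> U \<noteq> {}} \<in> sets lebesgue" .
qed

lemma set_measurable_If: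
  assumes "E \<in> sets lebesgue" "set_measurable F" "set_measurable G"
  shows "set_measurable (\<lambda>x. if x \<in> E then F x else G x)"
  unfolding set_measurable_def
proof safe
  fix U :: "'b set" assume "open U"
  then have "E \<inter> {x. F x \<inter> U \<noteq> {}} \<union> (- E) \<inter> {x. G x \<inter> U \<noteq> {}} \<in> sets lebesgue"
    using assms sets.compl_sets[OF assms(1)]
    by (intro sets.Un sets.Int) (auto simp: set_measurable_def Compl_eq_Diff_UNIV)
  moreover have "{x. (if x \<in> E then F x else G x) \<inter> U \<noteq> {}} =
      E \<inter> {x. F x \<inter> U \<noteq> {}} \<union> (- E) \<inter> {x. G x \<inter> U \<noteq> {}}" by auto
  ultimately show "{x. (if x \<in> E then F x else G x) \<inter> U \<noteq> {}} \<in> sets lebesgue" by simp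
qed

text \<open>The integrand is measurable in \<open>x\<close> and continuous in \<open>v\<close>. The
  supremum exceeds \<open>c\<close> exactly if some basic open set meets \<open>F x\<close> and
  \<open>g x\<close> stays above \<open>c\<close> by a fixed margin on it. By continuity the margin
  need only be tested on a countable dense set, which leaves countable set operations.\<close>

lemma borel_measurable_SUP_set:
  fixes F :: "'a::euclidean_space \<Rightarrow> 'b::euclidean_space set" and g :: "'a \<Rightarrow> 'b \<Rightarrow> real"
  assumes F: "set_measurable F" "\<And>x. F x \<noteq> {}" "\<And>x. compact (F x)"
    and g: "\<And>v. (\<lambda>x. g x v) \<in> borel_measurable lebesgue" "\<And>x. continuous_on UNIV (g x)"
  shows "(\<lambda>x. SUP v\<in>F x. g x v) \<in> borel_measurable lebesgue"
  unfolding borel_measurable_iff_greater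
proof
  fix c :: real
  obtain B :: "'b set set" where B: "countable B" "topological_basis B"
    using ex_countable_basis by blast
  obtain D :: "'b set" where D: "countable D" "\<And>X. open X \<Longrightarrow> X \<noteq> {} \<Longrightarrow> \<exists>d\<in>D. d \<in> X"
    using countable_dense_setE by blast
  have bdd: "bdd_above (g x ` F x)" for x
    using F(3)[of x] continuous_on_subset[OF g(2)[of x]]
    by (intro bounded_imp_bdd_above compact_imp_bounded compact_continuous_image) auto
  \<comment> \<open>The margin \<open>1 / real (Suc m)\<close> is there because only a non-strict
    inequality extends from the dense points of \<open>b\<close> to all of \<open>b\<close>; without
    it the strict inequality at a point of \<open>F x\<close> could be lost.\<close>
  let ?E = "\<lambda>b m. {x. F x \<inter> b \<noteq> {}} \<inter> {x. \<forall>d\<in>D \<inter> b. c + 1 / real (Suc m) \<le> g x d}"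
  have "{x \<in> space lebesgue. c < (SUP v\<in>F x. g x v)} = (\<Union>b\<in>B. \<Union>m. ?E b m)" (is "?L = ?R")
  proof
    show "?L \<subseteq> ?R"
    proof
      fix x assume "x \<in> ?L"
      then obtain v where v: "v \<in> F x" "c < g x v"
        using less_cSUP_iff[OF F(2) bdd] by auto
      then obtain m where m: "c + 1 / real (Suc m) < g x v"
        using reals_Archimedean[of "g x v - c"]
        by (auto simp: inverse_eq_divide less_diff_eq add.commute)
      have "open {w. c + 1 / real (Suc m) < g x w}"
        by (intro open_Collect_less continuous_intros g)
      then obtain b where b: "b \<in> B" "v \<in> b" "b \<subseteq> {w. c + 1 / real (Suc m) < g x w}"
        using B(2) m by (metis (no_types, lifting) mem_Collect_eq topological_basisE)
      then have "x \<in> ?E b m" using v by force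
      then show "x \<in> ?R" using b by blast
    qed
    show "?R \<subseteq> ?L"
    proof
      fix x assume "x \<in> ?R"
      then obtain b m v where b: "b \<in> B" "v \<in> F x" "v \<in> b"
        and d: "\<And>d. d \<in> D \<Longrightarrow> d \<in> b \<Longrightarrow> c + 1 / real (Suc m) \<le> g x d" by blast
      have "c + 1 / real (Suc m) \<le> g x v"
      proof (rule ccontr)
        assume "\<not> ?thesis"
        then have "v \<in> {w. g x w < c + 1 / real (Suc m)} \<inter> b" using b by auto
        moreover have "open ({w. g x w < c + 1 / real (Suc m)} \<inter> b)"
          using topological_basis_open[OF B(2) b(1)]
          by (intro open_Int open_Collect_less continuous_intros g)
        ultimately obtain e where "e \<in> D" "e \<in> {w. g x w < c + 1 / real (Suc m)} \<inter> b"
          using D(2) by blast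
        then show False using d[of e] by auto
      qed
      then have "c < g x v" by (smt (verit) of_nat_0_less_iff zero_less_Suc divide_pos_pos)
      then show "x \<in> ?L"
        using less_cSUP_iff[OF F(2) bdd] b by auto
    qed
  qed
  also have "\<dots> \<in> sets lebesgue"
  proof (intro sets.countable_UN'' B sets.countable_UN sets.Int)
    fix b m assume "b \<in> B"
    then show "{x. F x \<inter> b \<noteq> {}} \<in> sets lebesgue"
      using F topological_basis_open[OF B(2)] by (simp add: set_measurable_def)
    have "{x. \<forall>d\<in>D \<inter> b. c + 1 / real (Suc m) \<le> g x d} =
        (\<Inter>d\<in>D \<inter> b. {x \<in> space lebesgue. c + 1 / real (Suc m) \<le> g x d})" by auto
    also have "\<dots> \<in> sets lebesgue"
      using D(1) by (intro sets.countable_INT'' borel_measurable_le g) auto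
    finally show "{x. \<forall>d\<in>D \<inter> b. c + 1 / real (Suc m) \<le> g x d} \<in> sets lebesgue" .
  qed auto
  finally show "{x \<in> space lebesgue. c < (SUP v\<in>F x. g x v)} \<in> sets lebesgue" .
qed

lemma borel_measurable_INF_set:
  fixes F :: "'a::euclidean_space \<Rightarrow> 'b::euclidean_space set" and g :: "'a \<Rightarrow> 'b \<Rightarrow> real"
  assumes "set_measurable F" "\<And>x. F x \<noteq> {}" "\<And>x. compact (F x)"
    and g: "\<And>v. (\<lambda>x. g x v) \<in> borel_measurable lebesgue" "\<And>x. continuous_on UNIV (g x)"
  shows "(\<lambda>x. INF v\<in>F x. g x v) \<in> borel_measurable lebesgue"
proof -
  have "(\<lambda>x. SUP v\<in>F x. - g x v) \<in> borel_measurable lebesgue"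
    using assms by (intro borel_measurable_SUP_set continuous_intros) auto
  then have "(\<lambda>x. - (SUP v\<in>F x. - g x v)) \<in> borel_measurable lebesgue" by simp
  then show ?thesis by (simp add: Inf_real_def image_image)
qed

context
  fixes \<rho> :: "'a::euclidean_space \<Rightarrow> 'b::euclidean_space \<Rightarrow> real"
  assumes \<rho>: "norm_function \<rho>"
begin

lemma norm_function_is_norm: "is_norm (\<rho> x)"
  using \<rho> by (simp add: norm_function_def)

lemma borel_measurable_set_norm:
  assumes "set_measurable F" "\<And>x. F x \<in> K_bcs"
  shows "(\<lambda>x. set_norm (\<rho> x) (F x)) \<in> borel_measurable lebesgue"
  unfolding set_norm_def using assms \<rho>
  by (intro borel_measurable_SUP_set K_bcs_nonempty K_bcs_compact
      is_norm_continuous_on norm_function_is_norm)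
    (auto simp: norm_function_def)

text \<open>The distance from \<open>v\<close> to \<open>G x\<close> is measurable in
  \<open>x\<close> by the result on infima and continuous in \<open>v\<close>, so it is itself an
  admissible integrand for the supremum over \<open>F x\<close>.\<close>

lemma borel_measurable_hausdorff_dist:
  assumes "set_measurable F" "\<And>x. F x \<in> K_bcs" "set_measurable G" "\<And>x. G x \<in> K_bcs"
  shows "(\<lambda>x. hausdorff_dist (\<rho> x) (F x) (G x)) \<in> borel_measurable lebesgue"
proof -
  have *: "(\<lambda>x. SUP v\<in>F x. INF w\<in>G x. \<rho> x (v - w)) \<in> borel_measurable lebesgue"
    if F: "set_measurable F" "\<And>x. F x \<in> K_bcs" and G: "set_measurable G" "\<And>x. G x \<in> K_bcs"
    for F G :: "'a \<Rightarrow> 'b set"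
  proof (intro borel_measurable_SUP_set borel_measurable_INF_set F G K_bcs_nonempty K_bcs_compact)
    show "(\<lambda>x. \<rho> x (v - w)) \<in> borel_measurable lebesgue" for v w
      using \<rho> by (simp add: norm_function_def)
    show "continuous_on UNIV (\<lambda>w. \<rho> x (v - w))" for x v
      by (intro continuous_on_compose2[OF is_norm_continuous_on[OF norm_function_is_norm, of UNIV]]
          continuous_intros) auto
    show "continuous_on UNIV (\<lambda>v. INF w\<in>G x. \<rho> x (v - w))" for x
    proof (rule continuous_on_if_norm_nonexpansive[OF norm_function_is_norm[of x]])
      \<comment> \<open>A point of \<open>G x\<close> nearest to \<open>u\<close> is a competitor
        for \<open>v\<close>; hence the distance function is nonexpansive.\<close>
      fix v u
      obtain w where w: "w \<in> G x" "\<rho> x (u - w) \<le> (INF w\<in>G x. \<rho> x (u - w))"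
        using INF_norm_diff_le_iff[OF norm_function_is_norm G(2)] by blast
      have "\<rho> x (v - w) \<le> \<rho> x (u - w) + \<rho> x (v - u)"
        using is_normD(5)[OF norm_function_is_norm, of x "u - w" "v - u"] by simp
      then show "(INF w\<in>G x. \<rho> x (v - w)) \<le> (INF w\<in>G x. \<rho> x (u - w)) + \<rho> x (v - u)"
        using w INF_norm_diff_le_iff[OF norm_function_is_norm G(2)] by fastforce
    qed
  qed
  show ?thesis
    unfolding hausdorff_dist_def using assms by (intro borel_measurable_max *)
qed

end

section \<open>Minkowski sums under scaling and under the set norm\<close>

lemma scaleR_set_plus: "(*\<^sub>R) c ` (K + L) = (*\<^sub>R) c ` K + (*\<^sub>R) c ` (L :: 'b::real_vector set)"
proof (intro equalityI subsetI)
  fix v assume "v \<in> (*\<^sub>R) c ` K + (*\<^sub>R) c ` L"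
  then obtain a b where "v = c *\<^sub>R a + c *\<^sub>R b" "a \<in> K" "b \<in> L"
    by (auto elim!: set_plus_elim)
  then show "v \<in> (*\<^sub>R) c ` (K + L)"
    by (intro image_eqI[of _ _ "a + b"]) (auto simp: scaleR_add_right)
qed (auto elim!: set_plus_elim simp: scaleR_add_right intro!: set_plus_intro)

lemma scaleR_set_sum:
  fixes n :: nat and A :: "nat \<Rightarrow> 'b::real_vector set"
  shows "(*\<^sub>R) c ` (\<Sum>k<n. A k) = (\<Sum>k<n. (*\<^sub>R) c ` A k)"
  by (induction n) (simp_all add: scaleR_set_plus)

context
  fixes N :: "'b::euclidean_space \<Rightarrow> real"
  assumes N: "is_norm N"
begin

lemma set_norm_zero: "set_norm N {0} = 0"
  by (simp add: set_norm_def is_normD[OF N])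

lemma set_norm_plus:
  assumes "K \<in> K_bcs" "L \<in> K_bcs"
  shows "set_norm N (K + L) \<le> set_norm N K + set_norm N L"
  unfolding set_norm_le_iff[OF N K_bcs_plus[OF assms]]
proof
  fix v assume "v \<in> K + L"
  then obtain a b where "v = a + b" "a \<in> K" "b \<in> L" by (rule set_plus_elim)
  then show "N v \<le> set_norm N K + set_norm N L"
    using set_norm_upper[OF N assms(1), of a] set_norm_upper[OF N assms(2), of b]
      is_normD(5)[OF N, of a b] by simp
qed

lemma set_norm_scale:
  assumes "K \<in> K_bcs"
  shows "set_norm N ((*\<^sub>R) c ` K) \<le> \<bar>c\<bar> * set_norm N K"
  unfolding set_norm_le_iff[OF N K_bcs_scale[OF assms]]
  using set_norm_upper[OF N assms] by (auto simp: is_normD[OF N] intro!: mult_left_mono)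

lemma set_norm_sum:
  fixes n :: nat
  assumes "\<And>k. A k \<in> K_bcs"
  shows "set_norm N (\<Sum>k<n. A k) \<le> (\<Sum>k<n. set_norm N (A k))"
proof (induction n)
  case 0
  then show ?case by (simp add: set_norm_zero)
next
  case (Suc n)
  then show ?case using set_norm_plus[of "\<Sum>k<n. A k" "A n"] K_bcs_sum[of A n] assms by simp
qed

end

subsection \<open>Minkowski series\<close>

lemma incseq_sum_K_bcs:
  assumes "\<And>k. A k \<in> K_bcs"
  shows "incseq (\<lambda>n. \<Sum>k<n. A k)"
  by (intro incseq_SucI) (simp add: add.commute set_zero_plus2 zero_in_K_bcs assms)

text \<open>Since partial sums of symmetric convex sets increase, the closure of their union is the limit
  of the Minkowski series. At points of divergence, which form a null set below, the value is
  arbitrary.\<close>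

definition set_suminf :: "('b::euclidean_space \<Rightarrow> real) \<Rightarrow> (nat \<Rightarrow> 'b set) \<Rightarrow> 'b set" where
  "set_suminf N A =
    (if summable (\<lambda>k. set_norm N (A k)) then closure (\<Union>n. \<Sum>k<n. A k) else {0})"

context
  fixes N :: "'b::euclidean_space \<Rightarrow> real" and A :: "nat \<Rightarrow> 'b set"
  assumes N: "is_norm N" and A: "\<And>k. A k \<in> K_bcs"
begin

lemma norm_le_suminf_set_norm:
  assumes "summable (\<lambda>k. set_norm N (A k))" "v \<in> (\<Sum>k<n. A k)"
  shows "N v \<le> (\<Sum>k. set_norm N (A k))"
proof -
  have "N v \<le> (\<Sum>k<n. set_norm N (A k))"
    using set_norm_upper[OF N K_bcs_sum[OF A] assms(2)] set_norm_sum[OF N, of A n] A by force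
  also have "\<dots> \<le> (\<Sum>k. set_norm N (A k))"
    using assms(1) set_norm_nonneg[OF N A] by (intro sum_le_suminf) auto
  finally show ?thesis .
qed

lemma set_suminf_K_bcs: "set_suminf N A \<in> K_bcs"
proof (cases "summable (\<lambda>k. set_norm N (A k))")
  case True
  obtain c where c: "0 < c" "\<And>v. c * norm v \<le> N v" using is_norm_lower_bound N by blast
  have "norm v \<le> (\<Sum>k. set_norm N (A k)) / c" if "v \<in> (\<Union>n. \<Sum>k<n. A k)" for v
    using that norm_le_suminf_set_norm[OF True] c(2)[of v] c(1)
    by (auto simp: field_simps intro: order_trans)
  then have "bounded (\<Union>n. \<Sum>k<n. A k)" by (rule boundedI)
  then show ?thesis
    using True unfolding set_suminf_def
    by (auto intro!: K_bcs_closure_Union K_bcs_sum incseq_sum_K_bcs A)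
qed (simp add: set_suminf_def K_bcs_singleton_zero)

lemma set_norm_set_suminf:
  assumes "summable (\<lambda>k. set_norm N (A k))"
  shows "set_norm N (set_suminf N A) \<le> (\<Sum>k. set_norm N (A k))"
proof -
  have "closure (\<Union>n. \<Sum>k<n. A k) \<subseteq> {v. N v \<le> (\<Sum>k. set_norm N (A k))}"
    using norm_le_suminf_set_norm[OF assms]
    by (intro closure_minimal closed_Collect_le is_norm_continuous_on[OF N] continuous_intros) auto
  then show ?thesis
    using assms unfolding set_norm_le_iff[OF N set_suminf_K_bcs] by (auto simp: set_suminf_def)
qed

lemma sum_subset_set_suminf:
  assumes "summable (\<lambda>k. set_norm N (A k))"
  shows "(\<Sum>k<n. A k) \<subseteq> set_suminf N A"
  using assms closure_subset[of "\<Union>n. \<Sum>k<n. A k"] by (auto simp: set_suminf_def)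

end

context
  fixes N :: "'b::euclidean_space \<Rightarrow> real" and A :: "nat \<Rightarrow> 'b set"
  assumes N: "is_norm N" and A: "\<And>k. A k \<in> K_bcs"
    and summable: "summable (\<lambda>k. set_norm N (A k))"
begin

text \<open>The right-hand side is a sum of compact sets and hence closed, so it suffices to place
  every partial sum in it. Passing from \<open>m\<close> to \<open>n + m\<close> terms enlarges the
  sum and makes the first \<open>n\<close> terms available to split off, even when
  \<open>m < n\<close>.\<close>

lemma set_suminf_split:
  "set_suminf N A \<subseteq> (\<Sum>k<n. A k) + set_suminf N (\<lambda>k. A (n + k))"
proof -
  let ?R = "set_suminf N (\<lambda>k. A (n + k))"
  have R: "?R \<in> K_bcs" by (intro set_suminf_K_bcs N A)
  have summable': "summable (\<lambda>k. set_norm N (A (n + k)))"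
    using summable_ignore_initial_segment[OF summable, of n] by (simp add: add.commute)
  have "(\<Sum>k<m. A k) \<subseteq> (\<Sum>k<n. A k) + ?R" for m
  proof -
    have "(\<Sum>k<m. A k) \<subseteq> (\<Sum>k<n + m. A k)"
      using incseqD[OF incseq_sum_K_bcs[OF A], of m "n + m"] by simp
    also have "(\<Sum>k<n + m. A k) = (\<Sum>k<n. A k) + (\<Sum>k<m. A (n + k))"
      by (induction m) (simp_all add: add.assoc)
    also have "\<dots> \<subseteq> (\<Sum>k<n. A k) + ?R"
      by (intro set_plus_mono2 order_refl sum_subset_set_suminf N A summable')
    finally show ?thesis .
  qed
  then have "closure (\<Union>n. \<Sum>k<n. A k) \<subseteq> (\<Sum>k<n. A k) + ?R"
    using K_bcs_compact[OF K_bcs_plus[OF K_bcs_sum[OF A] R]]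
    by (intro closure_minimal compact_imp_closed) auto
  then show ?thesis using summable by (simp add: set_suminf_def)
qed

text \<open>One of the two excesses is zero, as the partial sum lies in the full sum. For the other,
  the tail component of a point is the error, and its norm is at most the scalar tail.\<close>

lemma hausdorff_dist_set_suminf:
  "hausdorff_dist N (\<Sum>k<n. A k) (set_suminf N A) \<le> (\<Sum>k. set_norm N (A (n + k)))"
proof -
  let ?R = "set_suminf N (\<lambda>k. A (n + k))"
  have summable': "summable (\<lambda>k. set_norm N (A (n + k)))"
    using summable_ignore_initial_segment[OF summable, of n] by (simp add: add.commute)
  have pos: "0 \<le> (\<Sum>k. set_norm N (A (n + k)))"
    using summable' set_norm_nonneg[OF N A] by (intro suminf_nonneg)
  have "\<exists>w\<in>\<Sum>k<n. A k. N (v - w) \<le> (\<Sum>k. set_norm N (A (n + k)))"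
    if v: "v \<in> set_suminf N A" for v
  proof -
    obtain w r where "v = w + r" "w \<in> (\<Sum>k<n. A k)" and r: "r \<in> ?R"
      using set_plus_elim[OF subsetD[OF set_suminf_split[of n] v]] by metis
    moreover have "N r \<le> (\<Sum>k. set_norm N (A (n + k)))"
      using set_norm_upper[OF N set_suminf_K_bcs[OF N A] r]
        set_norm_set_suminf[OF N A summable'] by simp
    ultimately show ?thesis by (intro bexI[of _ w]) auto
  qed
  moreover have "\<exists>w\<in>set_suminf N A. N (v - w) \<le> (\<Sum>k. set_norm N (A (n + k)))"
    if "v \<in> (\<Sum>k<n. A k)" for v
    using that sum_subset_set_suminf[OF N A summable, of n] pos is_normD(2)[OF N]
    by (intro bexI[of _ v]) auto
  ultimately show ?thesis
    unfolding hausdorff_dist_le_iff[OF N K_bcs_sum[OF A] set_suminf_K_bcs[OF N A]] by blast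
qed

end

subsection \<open>Series in \<open>LpK\<close>\<close>

lemma LpK_D:
  assumes "F \<in> LpK p \<rho>"
  shows "F x \<in> K_bcs" "set_measurable F" "LpK_norm p \<rho> F < \<infinity>"
  using assms by (auto simp: LpK_def)

context
  fixes p :: ennreal and \<rho> :: "'a::euclidean_space \<Rightarrow> 'b::euclidean_space \<Rightarrow> real"
  assumes p: "1 \<le> p" and \<rho>: "norm_function \<rho>"
begin

lemmas is_norm = norm_function_is_norm[OF \<rho>]

lemma borel_measurable_set_norm_LpK:
  "F \<in> LpK p \<rho> \<Longrightarrow> (\<lambda>x. set_norm (\<rho> x) (F x)) \<in> borel_measurable lebesgue"
  by (intro borel_measurable_set_norm \<rho> LpK_D)

lemma set_norm_LpK_nonneg: "F \<in> LpK p \<rho> \<Longrightarrow> 0 \<le> set_norm (\<rho> x) (F x)"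
  by (intro set_norm_nonneg is_norm LpK_D)

lemma LpK_norm_AE_cong_le:
  assumes "F \<in> LpK p \<rho>" "AE x in lebesgue. F x = G x"
  shows "LpK_norm p \<rho> F \<le> LpK_norm p \<rho> G"
  unfolding LpK_norm_def
  using assms set_norm_LpK_nonneg[OF assms(1)]
  by (intro Lp_norm_mono p borel_measurable_set_norm_LpK) (auto elim!: eventually_mono)

lemma LpK_norm_plus:
  assumes "F \<in> LpK p \<rho>" "G \<in> LpK p \<rho>"
  shows "LpK_norm p \<rho> (\<lambda>x. F x + G x) \<le> LpK_norm p \<rho> F + LpK_norm p \<rho> G"
proof -
  have "LpK_norm p \<rho> (\<lambda>x. F x + G x) \<le>
      Lp_norm p (\<lambda>x. set_norm (\<rho> x) (F x) + set_norm (\<rho> x) (G x))"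
    unfolding LpK_norm_def
    by (intro Lp_norm_mono p borel_measurable_set_norm \<rho> set_measurable_plus K_bcs_plus AE_I2 conjI
        set_norm_plus set_norm_nonneg is_norm LpK_D(1,2)[OF assms(1)] LpK_D(1,2)[OF assms(2)])
  also have "\<dots> \<le> LpK_norm p \<rho> F + LpK_norm p \<rho> G"
    unfolding LpK_norm_def using assms
    by (intro Lp_norm_add p borel_measurable_set_norm_LpK set_norm_LpK_nonneg)
  finally show ?thesis .
qed

lemma LpK_plus:
  assumes "F \<in> LpK p \<rho>" "G \<in> LpK p \<rho>"
  shows "(\<lambda>x. F x + G x) \<in> LpK p \<rho>"
proof -
  have "LpK_norm p \<rho> F + LpK_norm p \<rho> G < \<infinity>"
    using LpK_D(3)[OF assms(1)] LpK_D(3)[OF assms(2)] by simp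
  then show ?thesis
    using le_less_trans[OF LpK_norm_plus[OF assms]] LpK_D(1,2)[OF assms(1)] LpK_D(1,2)[OF assms(2)]
    by (simp add: LpK_def K_bcs_plus set_measurable_plus)
qed

lemma LpK_norm_scale:
  assumes "F \<in> LpK p \<rho>" "0 < c"
  shows "LpK_norm p \<rho> (\<lambda>x. (*\<^sub>R) c ` F x) \<le> ennreal c * LpK_norm p \<rho> F"
proof -
  have "LpK_norm p \<rho> (\<lambda>x. (*\<^sub>R) c ` F x) \<le> Lp_norm p (\<lambda>x. c * set_norm (\<rho> x) (F x))"
    unfolding LpK_norm_def
    using set_norm_scale[OF is_norm LpK_D(1)[OF assms(1)], where c=c] assms(2)
    by (intro Lp_norm_mono p borel_measurable_set_norm \<rho> set_measurable_scale K_bcs_scale AE_I2 conjI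
        set_norm_nonneg is_norm LpK_D(1,2)[OF assms(1)]) simp
  also have "\<dots> \<le> ennreal c * LpK_norm p \<rho> F"
    unfolding LpK_norm_def using assms
    by (intro Lp_norm_cmult p borel_measurable_set_norm_LpK set_norm_LpK_nonneg)
  finally show ?thesis .
qed

lemma LpK_scale:
  assumes "F \<in> LpK p \<rho>" "0 < c"
  shows "(\<lambda>x. (*\<^sub>R) c ` F x) \<in> LpK p \<rho>"
proof -
  have "ennreal c * LpK_norm p \<rho> F < \<infinity>"
    using LpK_D(3)[OF assms(1)] by (simp add: ennreal_mult_less_top)
  then show ?thesis
    using le_less_trans[OF LpK_norm_scale[OF assms]] LpK_D(1,2)[OF assms(1)]
    by (simp add: LpK_def K_bcs_scale set_measurable_scale)
qed

lemma LpK_zero: "(\<lambda>x. {0}) \<in> LpK p \<rho>"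
  using p by (simp add: LpK_def K_bcs_singleton_zero set_measurable_const LpK_norm_def
      set_norm_zero[OF is_norm] Lp_norm_zero)

lemma LpK_sum:
  fixes n :: nat
  assumes "\<And>k. F k \<in> LpK p \<rho>"
  shows "(\<lambda>x. \<Sum>k<n. F k x) \<in> LpK p \<rho>"
  by (induction n) (auto simp: LpK_zero LpK_plus assms)

text \<open>The pointwise triangle inequality and Minkowski's inequality make the distance of the
  two limits zero; the Hausdorff distance then vanishes a.e. and separates compact sets.\<close>

lemma LpK_tendsto_unique:
  assumes "LpK_tendsto p \<rho> X F" "LpK_tendsto p \<rho> X G"
  shows "AE x in lebesgue. F x = G x"
proof -
  have X: "X n \<in> LpK p \<rho>" for n using assms by (simp add: LpK_tendsto_def)
  have FG: "F \<in> LpK p \<rho>" "G \<in> LpK p \<rho>" using assms by (auto simp: LpK_tendsto_def)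
  let ?d = "\<lambda>F G x. hausdorff_dist (\<rho> x) (F x) (G x)"
  have meas: "?d F G \<in> borel_measurable lebesgue" and nonneg: "0 \<le> ?d F G x"
    if "F \<in> LpK p \<rho>" "G \<in> LpK p \<rho>" for F G x
    using that by (auto intro!: borel_measurable_hausdorff_dist[OF \<rho>] hausdorff_dist_nonneg is_norm simp: LpK_D)
  have "LpK_dist p \<rho> F G \<le> LpK_dist p \<rho> (X n) F + LpK_dist p \<rho> (X n) G" for n
  proof -
    have "LpK_dist p \<rho> F G \<le> Lp_norm p (\<lambda>x. ?d (X n) F x + ?d (X n) G x)"
      unfolding LpK_dist_def
    proof (intro Lp_norm_mono p meas FG AE_I2 conjI nonneg)
      show "?d F G x \<le> ?d (X n) F x + ?d (X n) G x" for x
        using hausdorff_dist_triangle[OF is_norm LpK_D(1)[OF FG(1)] LpK_D(1)[OF X] LpK_D(1)[OF FG(2)]]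
        by (metis hausdorff_dist_commute)
    qed
    also have "\<dots> \<le> LpK_dist p \<rho> (X n) F + LpK_dist p \<rho> (X n) G"
      unfolding LpK_dist_def by (intro Lp_norm_add p meas X FG nonneg)
    finally show ?thesis .
  qed
  moreover have "(\<lambda>n. LpK_dist p \<rho> (X n) F + LpK_dist p \<rho> (X n) G) \<longlonglongrightarrow> 0 + 0"
    using assms unfolding LpK_tendsto_def by (intro tendsto_add) auto
  ultimately have "LpK_dist p \<rho> F G \<le> 0 + 0"
    by (intro LIMSEQ_le_const) auto
  then have "AE x in lebesgue. ?d F G x = 0"
    unfolding LpK_dist_def by (intro Lp_norm_eq_zero[OF p] meas FG nonneg) simp
  then show ?thesis
    by eventually_elim (rule hausdorff_dist_eq_zero[OF is_norm LpK_D(1)[OF FG(1)] LpK_D(1)[OF FG(2)]])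
qed

context
  fixes A :: "nat \<Rightarrow> 'a \<Rightarrow> 'b set" and m :: "nat \<Rightarrow> real"
  assumes A: "\<And>k. A k \<in> LpK p \<rho>"
    and m: "\<And>k. LpK_norm p \<rho> (A k) \<le> ennreal (m k)" "\<And>k. 0 \<le> m k" "summable m"
begin

text \<open>Applied to the terms of the series and, later, to the images of the tails under
  \<open>T\<close>, where summability forces their pointwise norms to tend to zero.\<close>

lemma AE_summable_set_norm: "AE x in lebesgue. summable (\<lambda>k. set_norm (\<rho> x) (A k x))"
  by (rule Lp_norm_suminf(1)[OF p borel_measurable_set_norm_LpK[OF A] set_norm_LpK_nonneg[OF A]
        m[unfolded LpK_norm_def]])

lemma set_measurable_set_suminf: "set_measurable (\<lambda>x. set_suminf (\<rho> x) (\<lambda>k. A k x))"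
proof -
  \<comment> \<open>The convergence set is written as finiteness of an extended-valued sum, which is
    measurable as a function of \<open>x\<close>.\<close>
  define E where "E = {x \<in> space lebesgue. (\<Sum>k. ennreal (set_norm (\<rho> x) (A k x))) \<noteq> \<infinity>}"
  have "(\<lambda>x. set_norm (\<rho> x) (A k x)) \<in> borel_measurable lebesgue" for k
    by (rule borel_measurable_set_norm_LpK[OF A])
  then have "(\<lambda>x. \<Sum>k. ennreal (set_norm (\<rho> x) (A k x))) \<in> borel_measurable lebesgue"
    by (intro borel_measurable_suminf_order measurable_compose[OF _ measurable_ennreal])
  then have E: "E \<in> sets lebesgue"
    unfolding E_def by (rule borel_measurable_neq) simp
  have E_iff: "x \<in> E \<longleftrightarrow> summable (\<lambda>k. set_norm (\<rho> x) (A k x))" for x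
  proof
    assume "x \<in> E"
    then show "summable (\<lambda>k. set_norm (\<rho> x) (A k x))"
      unfolding E_def by (intro summable_suminf_not_top set_norm_LpK_nonneg[OF A]) simp
  next
    assume "summable (\<lambda>k. set_norm (\<rho> x) (A k x))"
    then show "x \<in> E"
      unfolding E_def using suminf_ennreal2[OF set_norm_LpK_nonneg[OF A]] by simp
  qed
  have eq: "(\<lambda>x. set_suminf (\<rho> x) (\<lambda>k. A k x)) =
      (\<lambda>x. if x \<in> E then closure (\<Union>n. \<Sum>k<n. A k x) else {0})"
    by (simp only: set_suminf_def E_iff)
  show ?thesis
    unfolding eq
    by (intro set_measurable_If E set_measurable_closure_Union set_measurable_sum
        set_measurable_const LpK_D(2)[OF A])
qed

lemma LpK_norm_set_suminf:
  "LpK_norm p \<rho> (\<lambda>x. set_suminf (\<rho> x) (\<lambda>k. A k x)) \<le> ennreal (\<Sum>k. m k)"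
proof -
  have "LpK_norm p \<rho> (\<lambda>x. set_suminf (\<rho> x) (\<lambda>k. A k x)) \<le>
      Lp_norm p (\<lambda>x. \<Sum>k. set_norm (\<rho> x) (A k x))"
    unfolding LpK_norm_def
  proof (intro Lp_norm_mono p borel_measurable_set_norm \<rho> set_measurable_set_suminf
        set_suminf_K_bcs is_norm LpK_D(1)[OF A])
    show "AE x in lebesgue. 0 \<le> set_norm (\<rho> x) (set_suminf (\<rho> x) (\<lambda>k. A k x)) \<and>
        set_norm (\<rho> x) (set_suminf (\<rho> x) (\<lambda>k. A k x)) \<le> (\<Sum>k. set_norm (\<rho> x) (A k x))"
      using AE_summable_set_norm
      by eventually_elim
        (intro conjI set_norm_set_suminf set_norm_nonneg set_suminf_K_bcs is_norm LpK_D(1)[OF A])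
  qed
  also have "\<dots> \<le> ennreal (\<Sum>k. m k)"
    by (rule Lp_norm_suminf(2)[OF p borel_measurable_set_norm_LpK[OF A] set_norm_LpK_nonneg[OF A]
          m[unfolded LpK_norm_def]])
  finally show ?thesis .
qed

lemma LpK_set_suminf: "(\<lambda>x. set_suminf (\<rho> x) (\<lambda>k. A k x)) \<in> LpK p \<rho>"
  using le_less_trans[OF LpK_norm_set_suminf ennreal_less_top] set_measurable_set_suminf
  by (simp add: LpK_def set_suminf_K_bcs[OF is_norm LpK_D(1)[OF A]])

end

text \<open>The distance to the n-th partial sum is at most the n-th tail of \<open>m\<close>: the
  pointwise Hausdorff estimate holds a.e., and Minkowski's inequality for countable sums integrates
  it.\<close>

lemma LpK_tendsto_set_suminf:
  fixes A :: "nat \<Rightarrow> 'a \<Rightarrow> 'b set"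
  assumes A: "\<And>k. A k \<in> LpK p \<rho>"
    and m: "\<And>k. LpK_norm p \<rho> (A k) \<le> ennreal (m k)" "\<And>k. 0 \<le> m k" "summable m"
  shows "LpK_tendsto p \<rho> (\<lambda>n x. \<Sum>k<n. A k x) (\<lambda>x. set_suminf (\<rho> x) (\<lambda>k. A k x))"
  unfolding LpK_tendsto_def
proof (intro conjI allI)
  let ?S = "\<lambda>x. set_suminf (\<rho> x) (\<lambda>k. A k x)"
  show S: "?S \<in> LpK p \<rho>" using LpK_set_suminf[OF A m] .
  show X: "(\<lambda>x. \<Sum>k<n. A k x) \<in> LpK p \<rho>" for n using LpK_sum[OF A] .
  have bound: "LpK_dist p \<rho> (\<lambda>x. \<Sum>k<n. A k x) ?S \<le> ennreal (\<Sum>k. m (n + k))" for n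
  proof -
    have "AE x in lebesgue. 0 \<le> hausdorff_dist (\<rho> x) (\<Sum>k<n. A k x) (?S x) \<and>
        hausdorff_dist (\<rho> x) (\<Sum>k<n. A k x) (?S x) \<le> (\<Sum>k. set_norm (\<rho> x) (A (n + k) x))"
      using AE_summable_set_norm[OF A m]
      by eventually_elim
        (intro conjI hausdorff_dist_nonneg hausdorff_dist_set_suminf is_norm LpK_D(1)[OF A]
          LpK_D(1)[OF S] LpK_D(1)[OF X])
    then have "LpK_dist p \<rho> (\<lambda>x. \<Sum>k<n. A k x) ?S \<le>
        Lp_norm p (\<lambda>x. \<Sum>k. set_norm (\<rho> x) (A (n + k) x))"
      unfolding LpK_dist_def
      by (intro Lp_norm_mono p borel_measurable_hausdorff_dist \<rho> LpK_D(1,2)[OF S] LpK_D(1,2)[OF X])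
    also have "\<dots> \<le> ennreal (\<Sum>k. m (n + k))"
      using summable_ignore_initial_segment[OF m(3), of n]
      by (intro Lp_norm_suminf(2)[OF p borel_measurable_set_norm_LpK[OF A] set_norm_LpK_nonneg[OF A]
            m(1)[unfolded LpK_norm_def] m(2)]) (simp add: add.commute)
    finally show ?thesis .
  qed
  have "(\<lambda>n. \<Sum>k. m (n + k)) \<longlonglongrightarrow> 0"
    using suminf_exist_split2[OF m(3)] by (simp add: add.commute)
  then have tail: "(\<lambda>n. ennreal (\<Sum>k. m (n + k))) \<longlonglongrightarrow> 0"
    by (rule tendsto_ennrealI[of _ 0, simplified])
  show "(\<lambda>n. LpK_dist p \<rho> (\<lambda>x. \<Sum>k<n. A k x) ?S) \<longlonglongrightarrow> 0"
    by (rule tendsto_sandwich[OF _ _ tendsto_const tail]) (intro always_eventually allI zero_le bound)+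
qed

text \<open>The infimum defining the operator norm is itself admissible: after division by the norm
  of \<open>F\<close>, each admissible constant bounds one fixed quotient. If that norm is zero, a
  single admissible constant already gives the claim.\<close>

lemma LpK_norm_operator_le:
  assumes "op_norm p \<rho> T < \<infinity>" "F \<in> LpK p \<rho>"
  shows "LpK_norm p \<rho> (T F) \<le> op_norm p \<rho> T * LpK_norm p \<rho> F"
proof -
  let ?C = "{C. \<forall>F\<in>LpK p \<rho>. LpK_norm p \<rho> (T F) \<le> C * LpK_norm p \<rho> F}"
  obtain C where C: "C \<in> ?C"
    using assms(1) unfolding op_norm_def by (auto simp: Inf_less_iff)
  obtain r where r: "LpK_norm p \<rho> F = ennreal r" "0 \<le> r"
    using LpK_D(3)[OF assms(2)] by (cases "LpK_norm p \<rho> F") auto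
  show ?thesis
  proof (cases "r = 0")
    case True
    then show ?thesis using C assms(2) r by force
  next
    case False
    then have "LpK_norm p \<rho> (T F) / ennreal r \<le> D" if "D \<in> ?C" for D
      using that assms(2) r by (auto simp: divide_le_posI_ennreal mult.commute)
    then have "LpK_norm p \<rho> (T F) / ennreal r \<le> op_norm p \<rho> T"
      unfolding op_norm_def by (intro Inf_greatest)
    then have "LpK_norm p \<rho> (T F) / ennreal r * ennreal r \<le> op_norm p \<rho> T * ennreal r"
      by (rule mult_right_mono) simp
    then show ?thesis
      using False r by (simp add: ennreal_divide_times)
  qed
qed

end

text \<open>Each point of \<open>K\<close> is within \<open>set_norm N (R n)\<close> of
  \<open>L\<close>, hence at distance zero, and the distance to the compact set \<open>L\<close> is
  attained. This is the pointwise limit that removes the tail.\<close>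

lemma subset_if_excess_tendsto_zero:
  fixes K L :: "'b::euclidean_space set"
  assumes N: "is_norm N" and L: "L \<in> K_bcs" and R: "\<And>n. R n \<in> K_bcs"
    and sub: "\<And>n. K \<subseteq> L + R n" and lim: "(\<lambda>n. set_norm N (R n)) \<longlonglongrightarrow> 0"
  shows "K \<subseteq> L"
proof
  fix v assume "v \<in> K"
  have "(INF w\<in>L. N (v - w)) \<le> set_norm N (R n)" for n
  proof -
    obtain w r where "v = w + r" "w \<in> L" "r \<in> R n"
      using set_plus_elim[OF subsetD[OF sub[of n] \<open>v \<in> K\<close>]] by metis
    then show ?thesis
      using set_norm_upper[OF N R, of r n] unfolding INF_norm_diff_le_iff[OF N L]
      by (intro bexI[of _ w]) auto
  qed
  then have "(INF w\<in>L. N (v - w)) \<le> 0" using lim by (intro LIMSEQ_le_const) auto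
  then obtain w where w: "w \<in> L" "N (v - w) \<le> 0"
    unfolding INF_norm_diff_le_iff[OF N L] by blast
  then have "v = w" using is_normD(1,3)[OF N, of "v - w"] by simp
  with w show "v \<in> L" by simp
qed

subsection \<open>The iteration algorithm\<close>

theorem theorem7p6:
  fixes p :: ennreal
    and \<rho> :: "real ^ 'n \<Rightarrow> real ^ 'd \<Rightarrow> real"
    and T :: "(real ^ 'n \<Rightarrow> (real ^ 'd) set) \<Rightarrow> (real ^ 'n \<Rightarrow> (real ^ 'd) set)"
    and G :: "real ^ 'n \<Rightarrow> (real ^ 'd) set"
  assumes "1 \<le> p"
    and "norm_function \<rho>"
    and "LpK_operator p \<rho> T"
    and "0 < op_norm p \<rho> T" and "op_norm p \<rho> T < \<infinity>"
    and "sublinear_op p \<rho> T"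
    and "monotone_op p \<rho> T"
    and "G \<in> LpK p \<rho>"
  shows "(\<exists>SG. LpK_tendsto p \<rho> (rdf_partial_sum (enn2real (op_norm p \<rho> T)) T G) SG) \<and>
    (\<forall>SG. LpK_tendsto p \<rho> (rdf_partial_sum (enn2real (op_norm p \<rho> T)) T G) SG \<longrightarrow>
       (\<forall>x. SG x \<in> K_bcs) \<and> set_measurable SG \<and>
       (AE x in lebesgue. G x \<subseteq> SG x) \<and>
       LpK_norm p \<rho> SG \<le> 2 * LpK_norm p \<rho> G \<and>
       (AE x in lebesgue. T SG x \<subseteq> (*\<^sub>R) (2 * enn2real (op_norm p \<rho> T)) ` SG x))"
proof -
  note p = assms(1) and \<rho> = assms(2) and G = assms(8)
  note is_norm = norm_function_is_norm[OF \<rho>]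
  define t where "t = enn2real (op_norm p \<rho> T)"
  have t: "op_norm p \<rho> T = ennreal t" "0 < t"
    using assms(4,5) by (auto simp: t_def enn2real_positive_iff less_top)
  obtain g where g: "LpK_norm p \<rho> G = ennreal g" "0 \<le> g"
    using LpK_D(3)[OF G] by (cases "LpK_norm p \<rho> G") auto
  have T: "T F \<in> LpK p \<rho>" if "F \<in> LpK p \<rho>" for F
    using assms(3) that by (simp add: LpK_operator_def)
  have T_norm: "LpK_norm p \<rho> (T F) \<le> ennreal t * LpK_norm p \<rho> F" if "F \<in> LpK p \<rho>" for F
    using LpK_norm_operator_le[OF p \<rho> assms(5) that] t by simp
  have T_mono: "AE x in lebesgue. T F x \<subseteq> T H x"
    if "F \<in> LpK p \<rho>" "H \<in> LpK p \<rho>" "AE x in lebesgue. F x \<subseteq> H x" for F H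
    using assms(7) that by (simp add: monotone_op_def)
  have T_scale: "AE x in lebesgue. T (\<lambda>y. (*\<^sub>R) c ` F y) x = (*\<^sub>R) c ` T F x"
    and T_plus: "AE x in lebesgue. T (\<lambda>y. F y + H y) x \<subseteq> T F x + T H x"
    if "F \<in> LpK p \<rho>" "H \<in> LpK p \<rho>" for c F H
    using assms(6) that by (auto simp: sublinear_op_def)

  define A where "A k x = (*\<^sub>R) (2 powi (- int k) * t powi (- int k)) ` ((T ^^ k) G) x" for k x
  have coeff: "2 powi (- int k) * t powi (- int k) = 1 / (2 * t) ^ k" for k
    by (simp add: power_int_minus power_mult_distrib field_simps)
  have rdf: "rdf_partial_sum t T G = (\<lambda>n x. \<Sum>k<n. A k x)"
    by (simp add: rdf_partial_sum_def A_def fun_eq_iff)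
  have pow: "(T ^^ k) G \<in> LpK p \<rho>" "LpK_norm p \<rho> ((T ^^ k) G) \<le> ennreal (t ^ k * g)" for k
  proof (induction k)
    case (Suc k)
    show "(T ^^ Suc k) G \<in> LpK p \<rho>" using Suc T by simp
    have "LpK_norm p \<rho> ((T ^^ Suc k) G) \<le> ennreal t * LpK_norm p \<rho> ((T ^^ k) G)"
      using T_norm Suc by simp
    also have "\<dots> \<le> ennreal t * ennreal (t ^ k * g)"
      using Suc by (intro mult_left_mono) auto
    finally show "LpK_norm p \<rho> ((T ^^ Suc k) G) \<le> ennreal (t ^ Suc k * g)"
      using t g by (simp add: mult.assoc flip: ennreal_mult)
  qed (use G g in auto)
  have A: "A k \<in> LpK p \<rho>" for k
    unfolding A_def coeff using t by (intro LpK_scale p \<rho> pow) simp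

  \<comment> \<open>The norm of \<open>(T ^^ k) G\<close> is at most \<open>t ^ k * g\<close>, and
    the weight \<open>1 / (2 * t) ^ k\<close> leaves \<open>(1 / 2) ^ k * g\<close>. The geometric
    sum \<open>2 * g\<close> is the source of the factor 2 in the norm bound.\<close>
  define m where "m k = (1 / 2) ^ k * g" for k :: nat
  have m: "LpK_norm p \<rho> (A k) \<le> ennreal (m k)" "0 \<le> m k" "m sums (2 * g)" for k
  proof -
    have "LpK_norm p \<rho> (A k) \<le> ennreal (1 / (2 * t) ^ k) * LpK_norm p \<rho> ((T ^^ k) G)"
      unfolding A_def coeff using t by (intro LpK_norm_scale p \<rho> pow) simp
    also have "\<dots> \<le> ennreal (1 / (2 * t) ^ k) * ennreal (t ^ k * g)"
      using pow by (intro mult_left_mono) auto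
    also have "\<dots> = ennreal (1 / (2 * t) ^ k * (t ^ k * g))"
      using t g by (intro ennreal_mult[symmetric]) auto
    also have "1 / (2 * t) ^ k * (t ^ k * g) = m k"
      using t by (simp add: m_def power_mult_distrib field_simps)
    finally show "LpK_norm p \<rho> (A k) \<le> ennreal (m k)" .
    show "0 \<le> m k" using g by (simp add: m_def)
    show "m sums (2 * g)"
      unfolding m_def using sums_mult2[OF geometric_sums[of "1 / 2 :: real"], of g] by simp
  qed
  have m_tail: "summable (\<lambda>k. m (n + k))" "(\<Sum>k. m (n + k)) = (1 / 2) ^ n * (2 * g)" for n
  proof -
    have "(\<lambda>k. (1 / 2) ^ n * m k) sums ((1 / 2) ^ n * (2 * g))"
      using m(3) by (rule sums_mult)
    then have "(\<lambda>k. m (n + k)) sums ((1 / 2) ^ n * (2 * g))"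
      by (simp add: m_def power_add mult.assoc)
    then show "summable (\<lambda>k. m (n + k))" "(\<Sum>k. m (n + k)) = (1 / 2) ^ n * (2 * g)"
      by (auto simp: sums_iff)
  qed
  have summable_m: "summable m" using m_tail(1)[of 0] by simp

  define S where "S = (\<lambda>x. set_suminf (\<rho> x) (\<lambda>k. A k x))"
  define X where "X = (\<lambda>n x. \<Sum>k<n. A k x)"
  define R where "R = (\<lambda>n x. set_suminf (\<rho> x) (\<lambda>k. A (n + k) x))"
  have S: "S \<in> LpK p \<rho>" and S_norm: "LpK_norm p \<rho> S \<le> ennreal (2 * g)"
    using LpK_set_suminf[OF p \<rho> A m(1,2) summable_m]
      LpK_norm_set_suminf[OF p \<rho> A m(1,2) summable_m] m(3)
    by (simp_all add: S_def sums_iff)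
  have X: "X n \<in> LpK p \<rho>" for n unfolding X_def by (intro LpK_sum p \<rho> A)
  have R: "R n \<in> LpK p \<rho>" and R_norm: "LpK_norm p \<rho> (R n) \<le> ennreal ((1 / 2) ^ n * (2 * g))" for n
    using LpK_set_suminf[OF p \<rho> A m(1,2) m_tail(1)]
      LpK_norm_set_suminf[OF p \<rho> A m(1,2) m_tail(1), of n] m_tail(2)
    by (simp_all add: R_def)
  have tendsto_S: "LpK_tendsto p \<rho> (rdf_partial_sum t T G) S"
    unfolding rdf S_def by (intro LpK_tendsto_set_suminf[OF p \<rho> A m(1,2) summable_m])
  \<comment> \<open>One null set, where the scalar series of norms diverges, serves all
    \<open>n\<close> at once.\<close>
  have X_S: "AE x in lebesgue. \<forall>n. X n x \<subseteq> S x"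
    and S_split: "AE x in lebesgue. \<forall>n. S x \<subseteq> X n x + R n x"
    using AE_summable_set_norm[OF p \<rho> A m(1,2) summable_m]
    by (eventually_elim, auto simp: X_def S_def R_def intro!: sum_subset_set_suminf
        set_suminf_split is_norm LpK_D(1)[OF A] del: subsetI)+

  \<comment> \<open>Partial sums run over \<open>k < n\<close>, so \<open>X 1\<close> consists of
    the term \<open>k = 0\<close> alone, whose weight is one.\<close>
  have "G x = X 1 x" for x by (simp add: X_def A_def)
  then have G_S: "AE x in lebesgue. G x \<subseteq> S x"
    using X_S by (auto elim!: eventually_mono)

  \<comment> \<open>Applying \<open>T\<close> raises the power of \<open>T\<close> by one but leaves
    the weight unchanged, which falls short of the next term by a factor \<open>2 * t\<close>. This
    shift is the origin of the constant in the last claim.\<close>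
  have T_A: "AE x in lebesgue. T (A k) x = (*\<^sub>R) (2 * t) ` A (Suc k) x" for k
  proof -
    have "AE x in lebesgue. T (A k) x = (*\<^sub>R) (1 / (2 * t) ^ k) ` T ((T ^^ k) G) x"
      unfolding A_def coeff using T_scale[OF pow(1) G] .
    moreover have "(*\<^sub>R) (2 * t) ` A (Suc k) x = (*\<^sub>R) (1 / (2 * t) ^ k) ` T ((T ^^ k) G) x" for x
    proof -
      have "2 * t * (1 / (2 * t) ^ Suc k) = 1 / (2 * t) ^ k" using t by simp
      then show ?thesis
        unfolding A_def coeff image_image scaleR_scaleR by (simp only: funpow.simps comp_apply)
    qed
    ultimately show ?thesis by simp
  qed
  have T_X: "AE x in lebesgue. T (X n) x \<subseteq> (\<Sum>k<n. T (A k) x)" for n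
  proof (induction n)
    case 0
    \<comment> \<open>The empty sum is the constant \<open>{0}\<close>. Writing it as zero times
      \<open>G\<close>, whose values are nonempty, lets homogeneity with the scalar 0 show that
      \<open>T\<close> sends it to \<open>{0}\<close> a.e.\<close>
    have "X 0 = (\<lambda>x. (*\<^sub>R) 0 ` G x)"
      using K_bcs_nonempty[OF LpK_D(1)[OF G]] by (auto simp: X_def fun_eq_iff)
    then have "AE x in lebesgue. T (X 0) x = (*\<^sub>R) 0 ` T G x"
      using T_scale[OF G G, of 0] by simp
    then show ?case by eventually_elim auto
  next
    case (Suc n)
    have "X (Suc n) = (\<lambda>x. X n x + A n x)" by (simp add: X_def fun_eq_iff)
    then have "AE x in lebesgue. T (X (Suc n)) x \<subseteq> T (X n) x + T (A n) x"
      using T_plus[OF X A] by simp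
    with Suc show ?case
      by eventually_elim
        (simp only: sum.lessThan_Suc, erule order_trans, intro set_plus_mono2 order_refl)
  qed
  have T_X_S: "AE x in lebesgue. \<forall>n. T (X n) x \<subseteq> (*\<^sub>R) (2 * t) ` S x"
  proof -
    have "AE x in lebesgue. \<forall>n. T (X n) x \<subseteq> (\<Sum>k<n. T (A k) x)"
      "AE x in lebesgue. \<forall>k. T (A k) x = (*\<^sub>R) (2 * t) ` A (Suc k) x"
      using T_X T_A by (simp_all add: AE_all_countable)
    with X_S show ?thesis
    proof eventually_elim
      case (elim x)
      show ?case
      proof
        fix n
        \<comment> \<open>The shifted sum is \<open>X (Suc n)\<close> without its term
          \<open>A 0\<close>; adding that term can only enlarge the set, since it contains the
          origin.\<close>
        have "(\<Sum>k<n. A (Suc k) x) \<subseteq> X (Suc n) x"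
          unfolding X_def sum.lessThan_Suc_shift
          by (intro set_zero_plus2 zero_in_K_bcs LpK_D(1)[OF A])
        also have "X (Suc n) x \<subseteq> S x" using elim(1) by blast
        finally have "(*\<^sub>R) (2 * t) ` (\<Sum>k<n. A (Suc k) x) \<subseteq> (*\<^sub>R) (2 * t) ` S x"
          by (rule image_mono)
        moreover have "T (X n) x \<subseteq> (*\<^sub>R) (2 * t) ` (\<Sum>k<n. A (Suc k) x)"
          using elim(2,3) by (simp add: scaleR_set_sum)
        ultimately show "T (X n) x \<subseteq> (*\<^sub>R) (2 * t) ` S x" by blast
      qed
    qed
  qed
  have T_S_split: "AE x in lebesgue. \<forall>n. T S x \<subseteq> T (X n) x + T (R n) x"
    unfolding AE_all_countable
  proof
    fix n
    have "AE x in lebesgue. S x \<subseteq> X n x + R n x"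
      using S_split by (auto elim: eventually_mono)
    then have "AE x in lebesgue. T S x \<subseteq> T (\<lambda>x. X n x + R n x) x"
      by (rule T_mono[OF S LpK_plus[OF p \<rho> X R]])
    with T_plus[OF X R, of n n] show "AE x in lebesgue. T S x \<subseteq> T (X n) x + T (R n) x"
      by eventually_elim blast
  qed
  have T_R: "AE x in lebesgue. (\<lambda>n. set_norm (\<rho> x) (T (R n) x)) \<longlonglongrightarrow> 0"
  proof -
    have bound: "LpK_norm p \<rho> (T (R n)) \<le> ennreal (t * ((1 / 2) ^ n * (2 * g)))" for n
    proof -
      have "LpK_norm p \<rho> (T (R n)) \<le> ennreal t * ennreal ((1 / 2) ^ n * (2 * g))"
        by (rule order_trans[OF T_norm[OF R] mult_left_mono[OF R_norm]]) simp
      also have "\<dots> = ennreal (t * ((1 / 2) ^ n * (2 * g)))"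
        using t g by (intro ennreal_mult[symmetric]) auto
      finally show ?thesis .
    qed
    have "AE x in lebesgue. summable (\<lambda>n. set_norm (\<rho> x) (T (R n) x))"
    proof (rule AE_summable_set_norm[OF p \<rho> T[OF R] bound])
      show "0 \<le> t * ((1 / 2) ^ n * (2 * g))" for n using t g by simp
      show "summable (\<lambda>n. t * ((1 / 2) ^ n * (2 * g)))"
        by (intro summable_mult summable_mult2 summable_geometric) simp
    qed
    then show ?thesis by eventually_elim (rule summable_LIMSEQ_zero)
  qed
  have T_S: "AE x in lebesgue. T S x \<subseteq> (*\<^sub>R) (2 * t) ` S x"
    using T_X_S T_S_split T_R
  proof eventually_elim
    case (elim x)
    show ?case
    proof (rule subset_if_excess_tendsto_zero[OF is_norm _ _ _ elim(3)])
      show "(*\<^sub>R) (2 * t) ` S x \<in> K_bcs" by (intro K_bcs_scale LpK_D(1)[OF S])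
      show "T (R n) x \<in> K_bcs" for n using LpK_D(1)[OF T[OF R]] .
      \<comment> \<open>The bound for \<open>T (X n) x\<close> is a fixed set independent of
        \<open>n\<close>, so only the excess \<open>T (R n) x\<close> varies in the limit.\<close>
      show "T S x \<subseteq> (*\<^sub>R) (2 * t) ` S x + T (R n) x" for n
        by (rule order_trans[OF elim(2)[rule_format] set_plus_mono2[OF elim(1)[rule_format] order_refl]])
    qed
  qed

  have "(\<forall>x. F x \<in> K_bcs) \<and> set_measurable F \<and> (AE x in lebesgue. G x \<subseteq> F x) \<and>
      LpK_norm p \<rho> F \<le> 2 * LpK_norm p \<rho> G \<and>
      (AE x in lebesgue. T F x \<subseteq> (*\<^sub>R) (2 * t) ` F x)"
    if lim: "LpK_tendsto p \<rho> (rdf_partial_sum t T G) F" for F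
  proof -
    have F: "F \<in> LpK p \<rho>" using lim by (simp add: LpK_tendsto_def)
    have FS: "AE x in lebesgue. F x = S x" using LpK_tendsto_unique[OF p \<rho> lim tendsto_S] .
    \<comment> \<open>Here \<open>T\<close> has to be well defined on a.e. classes: \<open>F\<close>
      and \<open>S\<close> are possibly different representatives of the same limit.\<close>
    then have "AE x in lebesgue. T F x = T S x"
      using assms(3) F S unfolding LpK_operator_def by blast
    with FS T_S have "AE x in lebesgue. T F x \<subseteq> (*\<^sub>R) (2 * t) ` F x"
      by eventually_elim simp
    moreover have "AE x in lebesgue. G x \<subseteq> F x"
      using FS G_S by eventually_elim simp
    moreover have "LpK_norm p \<rho> F \<le> ennreal (2 * g)"
      using LpK_norm_AE_cong_le[OF p \<rho> F FS] S_norm by simp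
    ultimately show ?thesis
      using LpK_D(1,2)[OF F] g by (simp add: ennreal_mult)
  qed
  then show ?thesis using tendsto_S unfolding t_def by blast
qed

end
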